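(* Let $f:\mathbb{R}^{n}\to\mathbb{R}_{\infty}$ be a proper lower semi-continuous function, quadratically minorised and prox-regular at $\bar{x}$ for $0\in\partial f(\bar{x})$. Suppose in addition that $\mathcal{U}^{2}:=\operatorname{dom}q(\underline{\partial}^{2}f(\bar{x},0))(\cdot)$ satisfies $\mathcal{U}^{2}=\mathcal{U}$ and is a linear subspace, that $f$ has a tilt stable local minimum at $\bar{x}$ for $0\in\operatorname{rel-int}\partial f(\bar x)$, and that $\partial^{\infty}f(\bar{x}+u+v(u))=\{0\}$ for $v(u)\in\operatorname{argmin}_{v'\in\mathcal{V}\cap B_{\varepsilon}(0)}\{g(u+v')\}:\mathcal{U}\to\mathcal{V}$, $u\in B_{\varepsilon}^{\mathcal{U}}(0)$, where $g(w):=[\operatorname{co}h](w)$. Then there exists an $\varepsilon>0$ such that, for $g(w):=[\operatorname{co}h](w)$, the function $$u\mapsto g(u+v(u))=f(\bar{x}+u+v(u))$$ is $C^{1,1}$ smooth on $B_{\varepsilon}^{\mathcal{U}}(0)$, where $$\nabla_{u}\,g(u+v(u))=(e_{\mathcal{U}},\nabla v(u))^{T}\,\partial g(u+v(u))$$ and $e_{\mathcal{U}}$ is the identity operator on $\mathcal{U}$. Moreover, suppose we have a $\delta>0$ (with $\delta\le\varepsilon$) such that for all $z_{\mathcal{V}}\in B_{\delta}(0)\cap\mathcal{V}\subseteq\partial_{\mathcal{V}}f(\bar{x})$ we have a common $$\{v(u)\}=\operatorname{argmin}_{v\in\mathcal{V}\cap B_{\varepsilon}(0)}\{f(\bar{x}+u+v)-\langle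 z_{\mathcal{V}},v\rangle\}$$ for all $u\in B_{\varepsilon}(0)\cap\mathcal{U}$. Then $\mathcal{M}:=\{(u,v(u))\mid u\in B_{\varepsilon}^{\mathcal{U}}(0)\}$ is a $C^{1}$-smooth manifold on which $u\mapsto f(\bar{x}+u+v(u))$ is $C^{1,1}$ smooth on $B_{\delta}^{\mathcal{U}}(0)$, and $u\mapsto v(u)$ is continuously differentiable.
   Context: Notation: $\mathbb{R}_{\infty}=\mathbb{R}\cup\{+\infty\}$; balls are closed, and for a subspace $X$, $B_{\varepsilon}^{X}(0)=X\cap B_{\varepsilon}(0)$; $\delta_{C}$ is the indicator function of $C$ ($0$ on $C$, $+\infty$ off $C$); $\operatorname{co}h$ is the function whose epigraph is the closed convex hull of $\operatorname{epi}h$. Here $h(w):=f(\bar x+w)+\delta_{B^{\mathcal U}_\varepsilon(0)\oplus B^{\mathcal V}_\varepsilon(0)}(w)$, i.e. $f(\bar x+\cdot)$ localised near $0$. The letter $\varepsilon$ in the hypothesis on $\partial^\infty f$ and in the conclusion denotes the radius of this localisation. For the convex function $g$, $\partial g$ is its subdifferential. A function is $C^{1,1}$ if its gradient exists and is Lipschitz. $x'\to_{f}x$ means $x'\to x$ and $f(x')\to f(x)$. $\mathcal{S}(n)$: symmetric $n\times n$ matrices. Proximal subdifferential: $z\in\partial_{p}f(x)$ iff for some $r\ge 0$, $f(x')\ge f(x)+\langle z,x'-x\rangle-\frac r2\|x'-x\|^{2}$ for all $x'$ near $x$. Limiting subdifferential: $\partial f(x)=\{z\mid\exists x_{k}\to_{f}x,\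 z_{k}\in\partial_{p}f(x_{k}),\ z_{k}\to z\}$. Singular limiting subdifferential: $\partial^{\infty}f(x)=\{z\mid\exists x_{k}\to_{f}x,\ z_{k}\in\partial_{p}f(x_{k}),\ \lambda_{k}\downarrow0,\ \lambda_{k}z_{k}\to z\}$. $\operatorname{rel-int}$ is the interior relative to the affine hull. $f$ is quadratically minorised if there is a quadratic function $\alpha-\frac R2\|x-\bar x\|^{2}$ lying below $f$ globally. $f$ is prox-regular at $\bar x$ for $\bar z\in\partial f(\bar x)$ if $f$ is finite and locally lower semi-continuous at $\bar x$, and for some $\varepsilon>0,r\ge 0$: $f(x')\ge f(x)+\langle z,x'-x\rangle-\frac r2\|x'-x\|^{2}$ whenever $\|x'-\bar x\|\le\varepsilon$, $\|x-\bar x\|\le\varepsilon$, $|f(x)-f(\bar x)|\le\varepsilon$, $\|z-\bar z\|\le\varepsilon$, $z\in\partial f(x)$. $\bar x$ gives a tilt stable local minimum of $f$ if $f(\bar x)$ is finite and for some $\varepsilon>0$ the mapping $z\mapsto\operatorname{argmin}_{\|x-\bar x\|\le\varepsilon}\{f(x)-\langle x,z\rangle\}$ is single valued and Lipschitz on a neighbourhood of $0$ with value $\bar x$ at $z=0$. Subjet: $\partial^{2,-}f(x)=\{(\nabla\varphi(x),\nabla^{2}\varphi(x))\mid \varphi\in C^{2}(\mathbb{R}^{n}),\ f-\varphi\text{ has a local minimum at }x\}$. $\underline{\partial}^{2}f(x)$ is the set of limits of $(z_{k},Q_{k})\in\partial^{2,-}f(x_{k})$ with $x_{k}\to_{f}x$;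 $\underline{\partial}^{2}f(x,z)=\{Q\in\mathcal{S}(n)\mid(z,Q)\in\underline{\partial}^{2}f(x)\}$; $q(\mathcal{A})(h)=\sup\{\langle Qh,h\rangle\mid Q\in\mathcal{A}\}$ and $\operatorname{dom}q(\mathcal A)(\cdot)=\{h\mid q(\mathcal{A})(h)<\infty\}$. $\mathcal{VU}$-decomposition (here $\bar z=0$): $\mathcal{V}:=\operatorname{span}\{\partial f(\bar x)-\bar z\}$, $\mathcal{U}:=\mathcal{V}^{\perp}$; $\partial_{\mathcal{V}}f(\bar x):=P_{\mathcal{V}}(\partial f(\bar x))$ with $P_{\mathcal{V}}$ the orthogonal projection onto $\mathcal V$.
   Formalization: The formula for ∇_u g(u+v(u)) is asserted only for |u|<ε and where ∇v(u) exists: under the first part's hypotheses v can have kinks accumulating at 0, and on |u|=ε the set ∂g(u+v(u)) contains outward normals, so the right side is not a single vector. *)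

theory Defs
  imports "HOL-Analysis.Analysis"
begin

text \<open>
  Functions into \<open>\<real> \<union> {+\<infinity>}\<close> are rendered as \<^typ>\<open>ereal\<close>-valued functions that never take the
  value \<open>-\<infinity>\<close>; that restriction is part of \<open>proper_fun\<close>.
\<close>

definition proper_fun :: "('a \<Rightarrow> ereal) \<Rightarrow> bool" where
  "proper_fun f \<longleftrightarrow> (\<forall>x. f x \<noteq> -\<infinity>) \<and> (\<exists>x. f x \<noteq> \<infinity>)"

definition lsc_fun :: "('a::topological_space \<Rightarrow> ereal) \<Rightarrow> bool" where
  "lsc_fun f \<longleftrightarrow> (\<forall>x. f x \<le> Liminf (at x) f)"

text \<open>Local lower semicontinuity at a point of finiteness, in the sense of Rockafellar and Wets:
  the epigraph is closed near \<open>(xb, f xb)\<close>.\<close>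

definition locally_lsc_at :: "('a::real_normed_vector \<Rightarrow> ereal) \<Rightarrow> 'a \<Rightarrow> bool" where
  "locally_lsc_at f xb \<longleftrightarrow>
     (\<exists>\<epsilon>>0. \<forall>\<alpha>::real. ereal \<alpha> \<le> f xb + ereal \<epsilon> \<longrightarrow> closed {x \<in> cball xb \<epsilon>. f x \<le> ereal \<alpha>})"

definition quadratically_minorised :: "('a::real_normed_vector \<Rightarrow> ereal) \<Rightarrow> 'a \<Rightarrow> bool" where
  "quadratically_minorised f xb \<longleftrightarrow>
     (\<exists>(\<alpha>::real) (R::real). \<forall>x. ereal (\<alpha> - R / 2 * (norm (x - xb))\<^sup>2) \<le> f x)"

text \<open>As usual in variational analysis, the argmin of a function that is identically \<open>+\<infinity>\<close> on the
  constraint set is empty.\<close>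

definition argmin_on :: "'a set \<Rightarrow> ('a \<Rightarrow> ereal) \<Rightarrow> 'a set" where
  "argmin_on C F = {x \<in> C. F x < \<infinity> \<and> (\<forall>y\<in>C. F x \<le> F y)}"

text \<open>The set indicator of convex analysis (\<open>0\<close> on \<open>C\<close>, \<open>+\<infinity>\<close> off \<open>C\<close>).\<close>

definition indicator_infty :: "'a set \<Rightarrow> 'a \<Rightarrow> ereal" where
  "indicator_infty C w = (if w \<in> C then 0 else \<infinity>)"

definition epi :: "('a \<Rightarrow> ereal) \<Rightarrow> ('a \<times> real) set" where
  "epi h = {(x, \<alpha>). h x \<le> ereal \<alpha>}"

text \<open>The closed convex hull of an epigraph is closed and closed upwards, hence is the epigraph of
  its lower boundary function.\<close>

definition co :: "('a::real_normed_vector \<Rightarrow> ereal) \<Rightarrow> 'a \<Rightarrow> ereal" where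
  "co h w = Inf {ereal \<alpha> |\<alpha>. (w, \<alpha>) \<in> closure (convex hull (epi h))}"

definition convex_subdiff :: "('a::real_inner \<Rightarrow> ereal) \<Rightarrow> 'a \<Rightarrow> 'a set" where
  "convex_subdiff g w =
     {z. \<bar>g w\<bar> \<noteq> \<infinity> \<and> (\<forall>y. g y \<ge> g w + ereal (z \<bullet> (y - w)))}"

definition f_converges ::
  "('a::topological_space \<Rightarrow> ereal) \<Rightarrow> (nat \<Rightarrow> 'a) \<Rightarrow> 'a \<Rightarrow> bool" where
  "f_converges f xs x \<longleftrightarrow> xs \<longlonglongrightarrow> x \<and> (\<lambda>k. f (xs k)) \<longlonglongrightarrow> f x"

definition prox_subdiff :: "('a::real_inner \<Rightarrow> ereal) \<Rightarrow> 'a \<Rightarrow> 'a set" where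
  "prox_subdiff f x =
     {z. \<bar>f x\<bar> \<noteq> \<infinity> \<and>
         (\<exists>r\<ge>0. \<forall>\<^sub>F x' in nhds x.
            f x' \<ge> f x + ereal (z \<bullet> (x' - x) - r / 2 * (norm (x' - x))\<^sup>2))}"

definition lim_subdiff :: "('a::real_inner \<Rightarrow> ereal) \<Rightarrow> 'a \<Rightarrow> 'a set" where
  "lim_subdiff f x =
     {z. \<exists>xs zs. f_converges f xs x \<and> (\<forall>k. zs k \<in> prox_subdiff f (xs k)) \<and> zs \<longlonglongrightarrow> z}"

definition singular_subdiff :: "('a::real_inner \<Rightarrow> ereal) \<Rightarrow> 'a \<Rightarrow> 'a set" where
  "singular_subdiff f x =
     {z. \<exists>xs zs (ts :: nat \<Rightarrow> real).
          f_converges f xs x \<and> (\<forall>k. zs k \<in> prox_subdiff f (xs k)) \<and>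
          (\<forall>k. ts k > 0) \<and> decseq ts \<and> ts \<longlonglongrightarrow> 0 \<and> (\<lambda>k. ts k *\<^sub>R zs k) \<longlonglongrightarrow> z}"

definition prox_regular :: "('a::real_inner \<Rightarrow> ereal) \<Rightarrow> 'a \<Rightarrow> 'a \<Rightarrow> bool" where
  "prox_regular f xb zb \<longleftrightarrow>
     zb \<in> lim_subdiff f xb \<and> \<bar>f xb\<bar> \<noteq> \<infinity> \<and> locally_lsc_at f xb \<and>
     (\<exists>\<epsilon>>0. \<exists>r\<ge>0. \<forall>x x' z.
        norm (x' - xb) \<le> \<epsilon> \<and> norm (x - xb) \<le> \<epsilon> \<and> \<bar>f x - f xb\<bar> \<le> ereal \<epsilon> \<and>
        norm (z - zb) \<le> \<epsilon> \<and> z \<in> lim_subdiff f x \<longrightarrow>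
        f x' \<ge> f x + ereal (z \<bullet> (x' - x) - r / 2 * (norm (x' - x))\<^sup>2))"

definition tilt_stable_local_min :: "('a::real_inner \<Rightarrow> ereal) \<Rightarrow> 'a \<Rightarrow> bool" where
  "tilt_stable_local_min f xb \<longleftrightarrow>
     \<bar>f xb\<bar> \<noteq> \<infinity> \<and>
     (\<exists>\<epsilon>>0. \<exists>\<rho>>0. \<exists>m L.
        (\<forall>z\<in>ball 0 \<rho>. argmin_on (cball xb \<epsilon>) (\<lambda>x. f x - ereal (x \<bullet> z)) = {m z}) \<and>
        L-lipschitz_on (ball 0 \<rho>) m \<and> m 0 = xb)"

text \<open>\<open>grad\<close> and \<open>hess\<close> are the gradient and the (automatically symmetric) Hessian of the \<open>C\<^sup>2\<close>
  function \<open>\<phi>\<close>.\<close>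

definition C2_with ::
  "(real^'n \<Rightarrow> real) \<Rightarrow> (real^'n \<Rightarrow> real^'n) \<Rightarrow> (real^'n \<Rightarrow> real^'n^'n) \<Rightarrow> bool" where
  "C2_with \<phi> grad hess \<longleftrightarrow>
     (\<forall>y. GDERIV \<phi> y :> grad y) \<and>
     (\<forall>y. (grad has_derivative (\<lambda>h. hess y *v h)) (at y)) \<and>
     continuous_on UNIV hess"

definition subjet :: "(real^'n \<Rightarrow> ereal) \<Rightarrow> real^'n \<Rightarrow> ((real^'n) \<times> (real^'n^'n)) set" where
  "subjet f x =
     {(grad x, hess x) |grad hess. \<bar>f x\<bar> \<noteq> \<infinity> \<and>
        (\<exists>\<phi>. C2_with \<phi> grad hess \<and>
             (\<forall>\<^sub>F x' in nhds x. f x - ereal (\<phi> x) \<le> f x' - ereal (\<phi> x')))}"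

definition lim_subjet :: "(real^'n \<Rightarrow> ereal) \<Rightarrow> real^'n \<Rightarrow> ((real^'n) \<times> (real^'n^'n)) set" where
  "lim_subjet f x =
     {(z, Q). \<exists>xs zs Qs. f_converges f xs x \<and> (\<forall>k. (zs k, Qs k) \<in> subjet f (xs k)) \<and>
                zs \<longlonglongrightarrow> z \<and> Qs \<longlonglongrightarrow> Q}"

definition lim_subhessians :: "(real^'n \<Rightarrow> ereal) \<Rightarrow> real^'n \<Rightarrow> real^'n \<Rightarrow> (real^'n^'n) set" where
  "lim_subhessians f x z = {Q. transpose Q = Q \<and> (z, Q) \<in> lim_subjet f x}"

definition rank1_support :: "(real^'n^'n) set \<Rightarrow> real^'n \<Rightarrow> ereal" where
  "rank1_support A h = (SUP Q\<in>A. ereal ((Q *v h) \<bullet> h))"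

definition effective_dom :: "('a \<Rightarrow> ereal) \<Rightarrow> 'a set" where
  "effective_dom F = {h. F h < \<infinity>}"

definition Vspace :: "('a::real_inner \<Rightarrow> ereal) \<Rightarrow> 'a \<Rightarrow> 'a set" where
  "Vspace f xb = span (lim_subdiff f xb)"

definition Uspace :: "('a::real_inner \<Rightarrow> ereal) \<Rightarrow> 'a \<Rightarrow> 'a set" where
  "Uspace f xb = (Vspace f xb)\<^sup>\<bottom>"

definition Vball :: "('a::real_inner \<Rightarrow> ereal) \<Rightarrow> 'a \<Rightarrow> real \<Rightarrow> 'a set" where
  "Vball f xb \<epsilon> = Vspace f xb \<inter> cball 0 \<epsilon>"

definition Uball :: "('a::real_inner \<Rightarrow> ereal) \<Rightarrow> 'a \<Rightarrow> real \<Rightarrow> 'a set" where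
  "Uball f xb \<epsilon> = Uspace f xb \<inter> cball 0 \<epsilon>"

text \<open>For a subspace, \<^const>\<open>closest_point\<close> is the orthogonal projection.\<close>

definition V_subdiff :: "('a::euclidean_space \<Rightarrow> ereal) \<Rightarrow> 'a \<Rightarrow> 'a set" where
  "V_subdiff f xb = closest_point (Vspace f xb) ` lim_subdiff f xb"

definition localised :: "('a::real_inner \<Rightarrow> ereal) \<Rightarrow> 'a \<Rightarrow> real \<Rightarrow> 'a \<Rightarrow> ereal" where
  "localised f xb \<epsilon> w =
     f (xb + w) + indicator_infty {u + v |u v. u \<in> Uball f xb \<epsilon> \<and> v \<in> Vball f xb \<epsilon>} w"

definition gfun :: "('a::real_inner \<Rightarrow> ereal) \<Rightarrow> 'a \<Rightarrow> real \<Rightarrow> 'a \<Rightarrow> ereal" where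
  "gfun f xb \<epsilon> = co (localised f xb \<epsilon>)"

text \<open>The points \<open>v u\<close> lie in \<open>V\<close>; values of \<open>v\<close> off the \<open>U\<close>-ball are irrelevant.\<close>

definition argmin_selection ::
  "('a::real_inner \<Rightarrow> ereal) \<Rightarrow> 'a \<Rightarrow> real \<Rightarrow> ('a \<Rightarrow> 'a) \<Rightarrow> bool" where
  "argmin_selection f xb \<epsilon> v \<longleftrightarrow>
     (\<forall>u\<in>Uball f xb \<epsilon>. v u \<in> argmin_on (Vball f xb \<epsilon>) (\<lambda>v'. gfun f xb \<epsilon> (u + v')))"

text \<open>\<open>VU_transpose U V D z\<close> is \<open>(e\<^sub>U, D)\<^sup>T z = z\<^sub>U + D\<^sup>T z\<^sub>V\<close> for a linear map \<open>D : U \<rightarrow> V\<close>. Only the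
  restriction of \<open>D\<close> to \<open>U\<close> matters: precomposing with the projection onto \<open>U\<close> makes the
  adjoint take its values in \<open>U\<close>.\<close>

definition VU_transpose ::
  "'a::euclidean_space set \<Rightarrow> 'a set \<Rightarrow> ('a \<Rightarrow> 'a) \<Rightarrow> 'a \<Rightarrow> 'a" where
  "VU_transpose U V D z =
     closest_point U z + adjoint (\<lambda>d. D (closest_point U d)) (closest_point V z)"

text \<open>In the following two definitions \<open>S\<close> is a subset of the subspace \<open>U\<close>, so that derivatives
  within \<open>S\<close> only see directions in \<open>U\<close>; at points of the relative interior of \<open>S\<close> they are the
  derivatives of the function on \<open>U\<close>.\<close>

definition C11_with_gradient_on ::
  "'a::real_inner set \<Rightarrow> 'a set \<Rightarrow> ('a \<Rightarrow> real) \<Rightarrow> ('a \<Rightarrow> 'a) \<Rightarrow> bool" where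
  "C11_with_gradient_on U S F G \<longleftrightarrow>
     (\<forall>u\<in>S. G u \<in> U \<and> (F has_derivative (\<lambda>d. G u \<bullet> d)) (at u within S)) \<and>
     (\<exists>L. L-lipschitz_on S G)"

definition C1_with_derivative_on ::
  "'a::real_normed_vector set \<Rightarrow> ('a \<Rightarrow> 'b::real_normed_vector) \<Rightarrow> ('a \<Rightarrow> 'a \<Rightarrow>\<^sub>L 'b) \<Rightarrow> bool" where
  "C1_with_derivative_on S F D \<longleftrightarrow>
     (\<forall>u\<in>S. (F has_derivative blinfun_apply (D u)) (at u within S)) \<and> continuous_on S D"

text \<open>Embedded \<open>C\<^sup>1\<close> manifolds, possibly with boundary, by local regular parametrisations: the
  parameter domain is relatively open in the half-space \<open>{x \<in> T. 0 \<le> a \<bullet> x}\<close> of a \<open>k\<close>-dimensional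
  subspace \<open>T\<close>, which is all of \<open>T\<close> for \<open>a = 0\<close>. A boundary has to be admitted because the manifold
  of interest is a graph over a closed ball.\<close>

definition C1_manifold :: "'a::euclidean_space set \<Rightarrow> bool" where
  "C1_manifold M \<longleftrightarrow>
     (\<exists>k. \<forall>p\<in>M. \<exists>W T a \<Omega> \<phi> \<phi>' D.
        openin (top_of_set M) W \<and> p \<in> W \<and>
        subspace T \<and> dim T = k \<and> openin (top_of_set {x \<in> T. 0 \<le> a \<bullet> x}) \<Omega> \<and>
        homeomorphism \<Omega> W \<phi> \<phi>' \<and>
        C1_with_derivative_on \<Omega> (\<phi> :: 'a \<Rightarrow> 'a) D \<and>
        (\<forall>x\<in>\<Omega>. \<forall>d\<in>T. blinfun_apply (D x) d = 0 \<longrightarrow> d = 0))"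

end

theory Submission
  imports Defs
begin

text \<open>
  Let \<open>F w = f (xb + w)\<close> and let \<open>M z\<close> be the minimiser of \<open>F - \<langle>z, \<cdot>\<rangle>\<close> near \<open>0\<close>. The conjugate
  \<open>\<phi> z = \<langle>z, M z\<rangle> - F (M z)\<close> is convex with Lipschitz gradient \<open>M\<close>, and the affine functions
  \<open>\<langle>z, \<cdot>\<rangle> - \<phi> z\<close> minorise \<open>F\<close> and touch it at \<open>M z\<close>. Prox-regularity and \<open>0 \<in> rel-int \<partial>f(xb)\<close> give
  \<open>M z = 0\<close> for small \<open>z \<in> V\<close>; finiteness of the second order support function on \<open>U\<close> makes \<open>M\<close>
  strongly monotone along \<open>U\<close>. Hence for small \<open>z \<in> V\<close>, \<open>u \<in> U\<close> there is a unique \<open>p \<in> U\<close> with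
  \<open>M (p + z) \<in> u + V\<close>, and \<open>p\<close> is Lipschitz in \<open>u\<close>. For \<open>z = 0\<close> the \<open>V\<close>-part of \<open>M p\<close> is \<open>v u\<close>, the affine
  minorant with slope \<open>p\<close> identifies \<open>g\<close> with \<open>F\<close> there, and \<open>p\<close> is the gradient of \<open>u \<mapsto> g (u + v u)\<close>.
  If \<open>v\<close> also solves the problems tilted by \<open>z\<close>, then \<open>\<langle>z, v u\<rangle>\<close> is a difference of two such
  \<open>C\<^sup>1\<^sup>,\<^sup>1\<close> functions, so \<open>v\<close> is \<open>C\<^sup>1\<close>.
\<close>

section \<open>First-order calculus relative to subsets and subspaces\<close>

text \<open>The subgradient inequalities at \<open>x\<close> and \<open>y\<close> trap the
  linearisation error between 0 and \<open>(G y - G x) \<bullet> (y - x)\<close>, which is at most L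
  |y - x|^2. An arbitrary \<open>S\<close> covers both the open ball of tilts and closed balls of
  \<open>U\<close>.\<close>

lemma has_derivative_of_subgradient_ineq:
  fixes G :: "'a::real_inner \<Rightarrow> 'a"
  assumes ineq: "\<And>x y. x \<in> S \<Longrightarrow> y \<in> S \<Longrightarrow> k y \<ge> k x + G x \<bullet> (y - x)"
    and lip: "L-lipschitz_on S G" and x: "x \<in> S"
  shows "(k has_derivative (\<lambda>d. G x \<bullet> d)) (at x within S)"
  unfolding has_derivative_within_alt
proof (intro conjI allI impI)
  show "bounded_linear ((\<bullet>) (G x))"
    by (rule bounded_linear_inner_right)
  fix e :: real assume e: "e > 0"
  have L: "L \<ge> 0"
    using lip lipschitz_on_nonneg by blast
  have "norm (k y - k x - G x \<bullet> (y - x)) \<le> e * norm (y - x)"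
    if y: "y \<in> S" and d: "norm (y - x) < e / (L + 1)" for y
  proof -
    have 1: "k y \<ge> k x + G x \<bullet> (y - x)" "k x \<ge> k y + G y \<bullet> (x - y)"
      using ineq x y by auto
    have "(G y - G x) \<bullet> (y - x) \<le> norm (G y - G x) * norm (y - x)"
      by (rule norm_cauchy_schwarz)
    also have "\<dots> \<le> (L * norm (y - x)) * norm (y - x)"
      using lipschitz_onD[OF lip y x] by (intro mult_right_mono) (auto simp: dist_norm)
    also have "\<dots> \<le> e * norm (y - x)"
    proof (rule mult_right_mono)
      have "L * norm (y - x) \<le> (L + 1) * norm (y - x)"
        by (simp add: mult_right_mono)
      also have "\<dots> \<le> e"
        using d L by (simp add: field_simps)
      finally show "L * norm (y - x) \<le> e" .
    qed simp
    finally show ?thesis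
      using 1 by (simp add: algebra_simps inner_diff_left inner_diff_right)
  qed
  then show "\<exists>d>0. \<forall>y\<in>S. norm (y - x) < d \<longrightarrow> norm (k y - k x - G x \<bullet> (y - x)) \<le> e * norm (y - x)"
    using e L by (intro exI[of _ "e / (L + 1)"]) auto
qed

text \<open>Fermat's rule on the line through \<open>p\<close> in direction \<open>d\<close>;
  \<open>norm p < s\<close> leaves room on both sides. With \<open>UNIV\<close> over the reals it
  also serves for functions of one variable.\<close>

lemma derivative_zero_of_min_on_subspace_ball:
  fixes p :: "'a::real_inner" and \<Psi> :: "'a \<Rightarrow> real"
  assumes U: "subspace U" and p: "p \<in> U" "norm p < s" and d: "d \<in> U"
    and der: "(\<Psi> has_derivative D) (at p)"
    and min: "\<And>q. q \<in> U \<Longrightarrow> norm q \<le> s \<Longrightarrow> \<Psi> p \<le> \<Psi> q"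
  shows "D d = 0"
proof -
  have "((\<lambda>t::real. p + t *\<^sub>R d) has_derivative (\<lambda>t. t *\<^sub>R d)) (at 0)"
    by (auto intro!: derivative_eq_intros)
  moreover have "(\<Psi> has_derivative D) (at (p + 0 *\<^sub>R d))"
    using der by simp
  ultimately have "((\<lambda>t. \<Psi> (p + t *\<^sub>R d)) has_derivative (\<lambda>t. D (t *\<^sub>R d))) (at 0)"
    by (rule has_derivative_compose)
  moreover have "(\<lambda>t. D (t *\<^sub>R d)) = (\<lambda>t. D d * t)"
    using has_derivative_linear[OF der] by (auto simp: linear_scale)
  ultimately have D: "DERIV (\<lambda>t. \<Psi> (p + t *\<^sub>R d)) 0 :> D d"
    by (simp add: has_field_derivative_def)
  let ?e = "(s - norm p) / (norm d + 1)"
  have "\<Psi> (p + 0 *\<^sub>R d) \<le> \<Psi> (p + t *\<^sub>R d)" if "\<bar>0 - t\<bar> < ?e" for t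
  proof -
    have "\<bar>t\<bar> * (norm d + 1) < s - norm p"
      using that pos_less_divide_eq[of "norm d + 1" "\<bar>t\<bar>" "s - norm p"]
      by (simp add: add_nonneg_pos)
    then have "norm p + \<bar>t\<bar> * norm d \<le> s"
      by (simp add: algebra_simps)
    then have "norm (p + t *\<^sub>R d) \<le> s"
      using norm_triangle_ineq[of p "t *\<^sub>R d"] by simp
    then show ?thesis
      using min[of "p + t *\<^sub>R d"] U p d by (simp add: subspace_add subspace_scale)
  qed
  moreover have "?e > 0"
    using p by (simp add: add_nonneg_pos)
  ultimately show ?thesis
    using DERIV_local_min[OF D, of ?e] by simp
qed

section \<open>The conjugate potential of a tilt stable function\<close>

text \<open>The base point is translated to the origin. Minimality of \<open>M z\<close> for the
  tilt \<open>z\<close> is written as an affine lower bound on \<open>F\<close> that touches at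
  \<open>M z\<close>.\<close>

locale tilted_minimisers =
  fixes F :: "'a::euclidean_space \<Rightarrow> ereal" and M :: "'a \<Rightarrow> 'a" and e \<rho> L :: real
  assumes e_pos: "0 < e" and \<rho>_pos: "0 < \<rho>"
    and M_zero: "M 0 = 0"
    and M_lipschitz: "L-lipschitz_on (ball 0 \<rho>) M"
    and M_mem: "\<And>z. norm z < \<rho> \<Longrightarrow> norm (M z) \<le> e"
    and F_finite: "\<And>z. norm z < \<rho> \<Longrightarrow> \<bar>F (M z)\<bar> \<noteq> \<infinity>"
    and M_min: "\<And>z w. norm z < \<rho> \<Longrightarrow> norm w \<le> e \<Longrightarrow> F (M z) + ereal (z \<bullet> (w - M z)) \<le> F w"
begin

definition \<phi> :: "'a \<Rightarrow> real" where
  "\<phi> z = z \<bullet> M z - real_of_ereal (F (M z))"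

lemma F_M: "norm z < \<rho> \<Longrightarrow> F (M z) = ereal (z \<bullet> M z - \<phi> z)"
  using F_finite[of z] by (simp add: \<phi>_def ereal_real')

lemma fenchel: "norm z < \<rho> \<Longrightarrow> norm w \<le> e \<Longrightarrow> ereal (z \<bullet> w - \<phi> z) \<le> F w"
  using M_min[of z w] by (simp add: F_M inner_diff_right algebra_simps)

text \<open>Fenchel's inequality for the tilt \<open>z'\<close> at the point \<open>M z\<close>,
  where the one for \<open>z\<close> is an equality.\<close>

lemma \<phi>_subgradient:
  assumes "norm z < \<rho>" "norm z' < \<rho>"
  shows "\<phi> z' \<ge> \<phi> z + M z \<bullet> (z' - z)"
  using fenchel[OF assms(2) M_mem[OF assms(1)]] assms
  by (simp add: F_M inner_diff_right inner_commute algebra_simps)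

lemma \<phi>_has_derivative:
  assumes "norm z < \<rho>"
  shows "(\<phi> has_derivative (\<lambda>d. M z \<bullet> d)) (at z)"
proof -
  have "(\<phi> has_derivative (\<lambda>d. M z \<bullet> d)) (at z within ball 0 \<rho>)"
    by (rule has_derivative_of_subgradient_ineq[OF _ M_lipschitz])
      (use assms \<phi>_subgradient in auto)
  then show ?thesis
    using assms at_within_open[of z "ball 0 \<rho>"] by simp
qed

lemma L_nonneg: "L \<ge> 0"
  using M_lipschitz lipschitz_on_nonneg by blast

lemma M_lip: "norm z < \<rho> \<Longrightarrow> norm z' < \<rho> \<Longrightarrow> norm (M z - M z') \<le> L * norm (z - z')"
  using lipschitz_onD[OF M_lipschitz, of z z'] by (simp add: dist_norm)

lemma norm_M_le: "norm z < \<rho> \<Longrightarrow> norm (M z) \<le> L * norm z"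
  using M_lip[of z 0] M_zero \<rho>_pos by simp

lemma \<phi>_continuous: "continuous_on (ball 0 \<rho>) \<phi>"
  by (meson \<phi>_has_derivative continuous_at_imp_continuous_on has_derivative_continuous mem_ball_0)

lemma \<phi>_le: "norm z < \<rho> \<Longrightarrow> \<phi> z \<le> \<phi> 0 + L * (norm z)\<^sup>2"
proof -
  assume z: "norm z < \<rho>"
  have "\<phi> z \<le> \<phi> 0 + M z \<bullet> z"
    using \<phi>_subgradient[OF z, of 0] \<rho>_pos by simp
  also have "M z \<bullet> z \<le> norm (M z) * norm z"
    by (rule norm_cauchy_schwarz)
  also have "\<dots> \<le> (L * norm z) * norm z"
    by (rule mult_right_mono[OF norm_M_le[OF z]]) simp
  finally show ?thesis by (simp add: power2_eq_square algebra_simps)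
qed

lemma \<phi>_ge: "norm z < \<rho> \<Longrightarrow> \<phi> 0 \<le> \<phi> z"
  using \<phi>_subgradient[of 0 z] \<rho>_pos M_zero by simp

text \<open>The minimiser \<open>z'\<close> of \<open>\<phi> + \<bar>\<cdot> - z\<bar>\<^sup>2 / (2 t)\<close> satisfies \<open>z' - z = - t M z'\<close>,
  and comparing the proximal inequality at \<open>0\<close> with the minimality of \<open>M z'\<close> forces \<open>M z' = 0\<close>.\<close>

lemma M_eq_0_of_prox_subgradients:
  assumes r: "r \<ge> 0" and \<sigma>: "\<sigma> > 0"
    and prox: "\<And>z w. z \<in> V \<Longrightarrow> norm z \<le> \<sigma> \<Longrightarrow> norm w \<le> \<sigma> \<Longrightarrow>
      F 0 + ereal (z \<bullet> w - r / 2 * (norm w)\<^sup>2) \<le> F w"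
  shows "\<exists>\<tau>>0. \<forall>z\<in>V. norm z \<le> \<tau> \<longrightarrow> M z = 0"
proof -
  \<comment> \<open>\<open>t - r / 2 = 1 + r / 2\<close> is the positive coefficient that forces
    \<open>M z' = 0\<close> at the end. \<open>s\<close> keeps tilts below \<open>\<rho>\<close> and
    the points \<open>M z'\<close> within the reach \<open>\<sigma>\<close> of \<open>prox\<close>;
    \<open>K\<close> makes \<open>z\<close> small enough to keep the minimiser off the
    sphere.\<close>
  define t where "t = r + 1"
  define s where "s = min (\<rho> / 2) (\<sigma> / (L + 1))"
  define K where "K = 1 + 2 * t * L"
  define \<tau> where "\<tau> = min \<sigma> (s / (4 * K))"
  have t: "t > 0" "K \<ge> 1" "s > 0"
    using r L_nonneg \<rho>_pos \<sigma> by (auto simp: t_def K_def s_def)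
  have s: "s < \<rho>" "L * s \<le> \<sigma>"
  proof -
    have "s \<le> \<rho> / 2" unfolding s_def by (rule min.cobounded1)
    then show "s < \<rho>" using \<rho>_pos by simp
    have "L * s \<le> L * (\<sigma> / (L + 1))"
      using L_nonneg by (intro mult_left_mono) (auto simp: s_def)
    also have "\<dots> \<le> \<sigma>" using L_nonneg \<sigma> by (simp add: field_simps)
    finally show "L * s \<le> \<sigma>" .
  qed
  have "M z = 0" if z: "z \<in> V" "norm z \<le> \<tau>" for z
  proof -
    have zs: "norm z * (4 * K) \<le> s" "norm z \<le> \<sigma>"
      using z t by (auto simp: \<tau>_def field_simps)
    have zs': "norm z \<le> s / 4"
      using mult_left_mono[of 1 K "norm z * 4"] zs t by (simp add: algebra_simps)
    define \<Psi> where "\<Psi> q = t * \<phi> q + (norm (q - z))\<^sup>2 / 2" for q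
    have "continuous_on (cball 0 s) \<Psi>"
      unfolding \<Psi>_def
      by (intro continuous_intros continuous_on_subset[OF \<phi>_continuous]) (use s in auto)
    then obtain z' where z': "norm z' \<le> s" and min: "\<And>q. norm q \<le> s \<Longrightarrow> \<Psi> z' \<le> \<Psi> q"
      using continuous_attains_inf[of "cball 0 s" \<Psi>] t by auto
    have z'\<rho>: "norm z' < \<rho>" using z' s by simp
    \<comment> \<open>On the sphere the quadratic term costs at least 9/32 s^2, whereas
      \<open>\<Psi> z\<close> exceeds \<open>t * \<phi> 0\<close> by at most 1/16 s^2.\<close>
    have "norm z' \<noteq> s"
    proof
      assume eq: "norm z' = s"
      have "norm (z' - z) \<ge> 3 / 4 * s"
        using norm_triangle_ineq2[of z' z] eq zs' by simp
      then have "(norm (z' - z))\<^sup>2 \<ge> (3 / 4 * s)\<^sup>2"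
        using t by (intro power_mono) auto
      moreover have "t * \<phi> 0 \<le> t * \<phi> z'"
        using \<phi>_ge[OF z'\<rho>] t by simp
      ultimately have 1: "\<Psi> z' \<ge> t * \<phi> 0 + 9 / 32 * s\<^sup>2"
        unfolding \<Psi>_def by (simp add: power_mult_distrib power_divide)
      have "\<Psi> z \<le> t * (\<phi> 0 + L * (norm z)\<^sup>2)"
        using \<phi>_le[of z] zs' s t by (simp add: \<Psi>_def)
      moreover have "\<Psi> z' \<le> \<Psi> z" using min[of z] zs' t by simp
      ultimately have "9 / 32 * s\<^sup>2 \<le> t * L * (norm z)\<^sup>2"
        using 1 by (simp add: algebra_simps)
      also have "\<dots> \<le> K * (norm z)\<^sup>2"
        using t L_nonneg by (intro mult_right_mono) (auto simp: K_def)
      also have "\<dots> = (K * norm z) * norm z" by (simp add: power2_eq_square)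
      also have "\<dots> \<le> (s / 4) * (s / 4)"
        using zs zs' t by (intro mult_mono) (auto simp: mult.commute mult.assoc mult.left_commute)
      finally show False using t by (simp add: power2_eq_square)
    qed
    then have z's: "norm z' < s" using z' by simp
    have der: "(\<Psi> has_derivative (\<lambda>d. t * (M z' \<bullet> d) + (z' - z) \<bullet> d)) (at z')"
    proof -
      have "((\<lambda>q. t * \<phi> q + (q - z) \<bullet> (q - z) / 2) has_derivative
          (\<lambda>d. t * (M z' \<bullet> d) + (z' - z) \<bullet> d)) (at z')"
        by (rule derivative_eq_intros \<phi>_has_derivative[OF z'\<rho>] refl)+
          (auto simp: inner_commute)
      moreover have "\<Psi> = (\<lambda>q. t * \<phi> q + (q - z) \<bullet> (q - z) / 2)"
        by (simp add: fun_eq_iff \<Psi>_def power2_norm_eq_inner)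
      ultimately show ?thesis by simp
    qed
    have "t * (M z' \<bullet> d) + (z' - z) \<bullet> d = 0" for d
      by (rule derivative_zero_of_min_on_subspace_ball[OF _ _ z's _ der, of UNIV]) (use min in auto)
    from this[of "t *\<^sub>R M z' + (z' - z)"] have crit: "t *\<^sub>R M z' + (z' - z) = 0"
      by (metis inner_add_left inner_eq_zero_iff inner_scaleR_left)
    have "norm (M z') \<le> L * s"
      using norm_M_le[OF z'\<rho>] mult_left_mono[OF z' L_nonneg] by simp
    then have "norm (M z') \<le> \<sigma>" using s by simp
    from prox[OF z(1) zs(2) this]
    have "z' \<bullet> M z' - \<phi> z' \<ge> - \<phi> 0 + (z \<bullet> M z' - r / 2 * (norm (M z'))\<^sup>2)"
      using F_M[of 0] F_M[OF z'\<rho>] \<rho>_pos M_zero by simp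
    moreover have "\<phi> 0 \<ge> \<phi> z' - M z' \<bullet> z'"
      using \<phi>_subgradient[OF z'\<rho>, of 0] \<rho>_pos by simp
    ultimately have "(z' - z) \<bullet> M z' \<ge> - (r / 2 * (norm (M z'))\<^sup>2) + 0"
      using \<phi>_ge[OF z'\<rho>] by (simp add: inner_diff_left inner_commute[of "M z'"])
    moreover have "(z' - z) \<bullet> M z' = - t * (norm (M z'))\<^sup>2"
    proof -
      have "z' - z = - t *\<^sub>R M z'"
        using crit by (simp add: algebra_simps add_eq_0_iff)
      then show ?thesis by (simp add: power2_norm_eq_inner)
    qed
    ultimately have "(1 + r / 2) * (norm (M z'))\<^sup>2 \<le> 0"
      by (simp add: t_def algebra_simps)
    then have "M z' = 0"
      using r by (auto simp: mult_le_0_iff)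
    \<comment> \<open>With \<open>M z' = 0\<close> the critical point equation reads
      \<open>z' = z\<close>.\<close>
    then show "M z = 0" using crit by simp
  qed
  moreover have "\<tau> > 0" using \<sigma> t by (simp add: \<tau>_def)
  ultimately show ?thesis by blast
qed

end

section \<open>Second-order contact and strong monotonicity along a subspace\<close>

text \<open>A Rolle argument: \<open>b\<close> makes the end values of \<open>\<omega>\<close>
  agree. If the maximum sat at an end, both ends would be maximal, so
  \<open>\<psi>' 0 \<le> b\<close> and \<open>\<psi>' T \<ge> \<kappa> * T + b\<close>, against
  \<open>slope\<close>. At an interior maximum the parabola is tangent to \<open>\<psi>\<close> from
  above.\<close>

lemma parabola_touches_above:
  fixes \<psi> \<psi>' :: "real \<Rightarrow> real"
  assumes T: "T > 0" and der: "\<And>t. 0 \<le> t \<Longrightarrow> t \<le> T \<Longrightarrow> DERIV \<psi> t :> \<psi>' t"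
    and slope: "\<psi>' T - \<psi>' 0 < \<kappa> * T"
  obtains t \<sigma> where "0 < t" "t < T" "\<sigma> > 0"
    "\<And>s. \<bar>s\<bar> < \<sigma> \<Longrightarrow> \<psi> (t + s) \<le> \<psi> t + s * \<psi>' t + \<kappa> / 2 * s\<^sup>2"
proof -
  define b where "b = (\<psi> T - \<psi> 0) / T - \<kappa> * T / 2"
  define \<omega> where "\<omega> t = \<psi> t - \<kappa> / 2 * t\<^sup>2 - b * t" for t
  have eq: "\<omega> T = \<omega> 0"
    using T by (simp add: \<omega>_def b_def field_simps power2_eq_square)
  have d\<omega>: "DERIV \<omega> t :> \<psi>' t - \<kappa> * t - b" if "0 \<le> t" "t \<le> T" for t
    unfolding \<omega>_def by (rule derivative_eq_intros der[OF that] refl)+ simp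
  have "continuous_on {0..T} \<omega>"
    using d\<omega> by (meson DERIV_continuous atLeastAtMost_iff continuous_at_imp_continuous_on)
  then obtain t where t: "0 \<le> t" "t \<le> T" and max: "\<And>s. 0 \<le> s \<Longrightarrow> s \<le> T \<Longrightarrow> \<omega> s \<le> \<omega> t"
    using continuous_attains_sup[of "{0..T}" \<omega>] T by fastforce
  have "t \<noteq> 0 \<and> t \<noteq> T"
  proof (rule ccontr)
    assume "\<not> ?thesis"
    then have max0: "\<omega> s \<le> \<omega> 0" "\<omega> s \<le> \<omega> T" if "0 \<le> s" "s \<le> T" for s
      using max[OF that] eq by auto
    have "\<psi>' 0 - b \<le> 0"
    proof (rule ccontr)
      assume "\<not> ?thesis"
      then obtain d where d: "d > 0" "\<And>s. 0 < s \<Longrightarrow> s < d \<Longrightarrow> \<omega> 0 < \<omega> (0 + s)"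
        using DERIV_pos_inc_right[OF d\<omega>[of 0]] T by auto
      moreover have "min (d / 2) T > 0" "min (d / 2) T < d" "min (d / 2) T \<le> T"
        using d(1) T by linarith+
      ultimately show False
        using max0(1)[of "min (d / 2) T"] by fastforce
    qed
    moreover have "\<psi>' T - \<kappa> * T - b \<ge> 0"
    proof (rule ccontr)
      assume "\<not> ?thesis"
      then obtain d where d: "d > 0" "\<And>s. 0 < s \<Longrightarrow> s < d \<Longrightarrow> \<omega> T < \<omega> (T - s)"
        using DERIV_neg_dec_left[OF d\<omega>[of T]] T by auto
      moreover have "min (d / 2) T > 0" "min (d / 2) T < d" "min (d / 2) T \<le> T"
        using d(1) T by linarith+
      ultimately show False
        using max0(2)[of "T - min (d / 2) T"] by fastforce
    qed
    ultimately show False using slope by simp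
  qed
  then have t': "0 < t" "t < T" using t by auto
  define \<sigma> where "\<sigma> = min t (T - t)"
  have loc: "\<omega> (t + s) \<le> \<omega> t" if "\<bar>s\<bar> < \<sigma>" for s
    using that by (intro max) (auto simp: \<sigma>_def)
  have \<sigma>: "\<sigma> > 0" using t' by (simp add: \<sigma>_def)
  have "\<psi>' t - \<kappa> * t - b = 0"
  proof (rule DERIV_local_max[OF d\<omega>[OF t] \<sigma>], intro allI impI)
    fix y assume "\<bar>t - y\<bar> < \<sigma>"
    then show "\<omega> y \<le> \<omega> t" using loc[of "y - t"] by (simp add: abs_minus_commute)
  qed
  then have b: "\<psi>' t = \<kappa> * t + b" by simp
  have "\<psi> (t + s) \<le> \<psi> t + s * \<psi>' t + \<kappa> / 2 * s\<^sup>2" if "\<bar>s\<bar> < \<sigma>" for s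
    using loc[OF that] unfolding b by (simp add: \<omega>_def power2_eq_square field_simps)
  then show ?thesis using that t' \<sigma> by blast
qed

text \<open>Curvatures are reciprocal under conjugation: a parabola of curvature
  \<open>\<kappa>\<close> above \<open>\<phi>\<close> along \<open>h\<close> yields one of curvature
  \<open>1 / \<kappa>\<close> below \<open>F\<close>, through the affine minorants with slopes
  \<open>z + s *\<^sub>R h\<close>.\<close>

lemma (in tilted_minimisers) quadratic_minorant_of_touching:
  assumes z: "norm z < \<rho>" "norm (M z) < e" and h: "norm h = 1"
    and \<kappa>: "\<kappa> > 0" and \<sigma>: "\<sigma> > 0"
    and touch: "\<And>s. \<bar>s\<bar> < \<sigma> \<Longrightarrow> \<phi> (z + s *\<^sub>R h) \<le> \<phi> z + s * (M z \<bullet> h) + \<kappa> / 2 * s\<^sup>2"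
    and R: "R * \<kappa> \<le> 1"
  shows "\<forall>\<^sub>F w in nhds (M z). F (M z) + ereal (z \<bullet> (w - M z) + R / 2 * (h \<bullet> (w - M z))\<^sup>2) \<le> F w"
proof -
  \<comment> \<open>The first bound keeps \<open>w\<close> in the ball of radius \<open>e\<close>;
    the second keeps |s| below \<open>\<sigma>\<close> and the slope in the domain of tilts.\<close>
  define \<delta> where "\<delta> = min (e - norm (M z)) (\<kappa> * min \<sigma> (\<rho> - norm z))"
  have \<delta>: "\<delta> > 0" using z \<kappa> \<sigma> by (simp add: \<delta>_def)
  have "F (M z) + ereal (z \<bullet> (w - M z) + R / 2 * (h \<bullet> (w - M z))\<^sup>2) \<le> F w"
    if w: "dist w (M z) < \<delta>" for w
  proof -
    define a where "a = h \<bullet> (w - M z)"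
    \<comment> \<open>This \<open>s\<close> maximises s a - \<kappa>/2 s^2, with value a^2 / (2
      \<kappa>) \<ge> R/2 a^2.\<close>
    define s where "s = a / \<kappa>"
    have wd: "norm (w - M z) < e - norm (M z)" "norm (w - M z) < \<kappa> * min \<sigma> (\<rho> - norm z)"
      using w by (auto simp: \<delta>_def dist_norm)
    have "\<bar>a\<bar> \<le> norm (w - M z)"
      using Cauchy_Schwarz_ineq2[of h "w - M z"] h by (simp add: a_def)
    then have "\<bar>a\<bar> < \<kappa> * min \<sigma> (\<rho> - norm z)" using wd by simp
    then have s: "\<bar>s\<bar> < min \<sigma> (\<rho> - norm z)"
      using \<kappa> pos_divide_less_eq[of \<kappa> "\<bar>a\<bar>" "min \<sigma> (\<rho> - norm z)"]
      by (simp only: s_def abs_divide mult.commute[of \<kappa>] abs_of_pos)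
    have "norm (z + s *\<^sub>R h) \<le> norm z + \<bar>s\<bar>"
      using norm_triangle_ineq[of z "s *\<^sub>R h"] h by simp
    then have zs: "norm (z + s *\<^sub>R h) < \<rho>" using s by simp
    have we: "norm w \<le> e"
      using wd norm_triangle_ineq[of "w - M z" "M z"] by simp
    have as: "a = \<kappa> * s" using \<kappa> by (simp add: s_def)
    have "R / 2 * a\<^sup>2 = (R * \<kappa>) * (\<kappa> * s\<^sup>2 / 2)"
      by (simp add: as power2_eq_square)
    also have "\<dots> \<le> 1 * (\<kappa> * s\<^sup>2 / 2)"
      using R \<kappa> by (intro mult_right_mono) auto
    also have "\<dots> = s * a - \<kappa> / 2 * s\<^sup>2"
      by (simp add: as power2_eq_square)
    finally have "R / 2 * a\<^sup>2 \<le> s * a - \<kappa> / 2 * s\<^sup>2" .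
    moreover have "\<phi> (z + s *\<^sub>R h) \<le> \<phi> z + s * (M z \<bullet> h) + \<kappa> / 2 * s\<^sup>2"
      using touch s by simp
    moreover have "s * a = s * (h \<bullet> w) - s * (M z \<bullet> h)"
      by (simp add: a_def inner_diff_right inner_commute algebra_simps)
    ultimately have "(z \<bullet> M z - \<phi> z) + (z \<bullet> (w - M z) + R / 2 * a\<^sup>2) \<le> (z + s *\<^sub>R h) \<bullet> w - \<phi> (z + s *\<^sub>R h)"
      by (simp add: inner_diff_right inner_add_left)
    then have "F (M z) + ereal (z \<bullet> (w - M z) + R / 2 * a\<^sup>2) \<le> ereal ((z + s *\<^sub>R h) \<bullet> w - \<phi> (z + s *\<^sub>R h))"
      by (simp add: F_M[OF z(1)])
    also have "\<dots> \<le> F w" by (rule fenchel[OF zs we])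
    finally show ?thesis by (simp add: a_def)
  qed
  then show ?thesis
    unfolding eventually_nhds_metric using \<delta> by blast
qed

definition outer_square :: "real^'n \<Rightarrow> real^'n^'n" where
  "outer_square h = (\<chi> i j. h $ i * h $ j)"

lemma outer_square_mult_vec: "(R *\<^sub>R outer_square h) *v x = (R * (h \<bullet> x)) *\<^sub>R h"
  by (simp add: vec_eq_iff outer_square_def matrix_vector_mult_def inner_vec_def sum_distrib_left
      sum_distrib_right algebra_simps)

lemma transpose_outer_square: "transpose (R *\<^sub>R outer_square h) = R *\<^sub>R outer_square h"
  by (simp add: vec_eq_iff outer_square_def transpose_def mult.commute)

lemma tendsto_outer_square:
  "(h \<longlongrightarrow> h') F \<Longrightarrow> ((\<lambda>k. R *\<^sub>R outer_square (h k)) \<longlongrightarrow> R *\<^sub>R outer_square h') F"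
  unfolding outer_square_def by (intro tendsto_intros) auto

text \<open>The quadratic minorant, normalised to vanish at \<open>x\<close>, is itself a global C^2
  test function with constant Hessian.\<close>

lemma outer_square_mem_subjet:
  fixes f :: "real^'n \<Rightarrow> ereal"
  assumes fin: "\<bar>f x\<bar> \<noteq> \<infinity>"
    and minor: "\<forall>\<^sub>F y in nhds x. f x + ereal (z \<bullet> (y - x) + R / 2 * (h \<bullet> (y - x))\<^sup>2) \<le> f y"
  shows "(z, R *\<^sub>R outer_square h) \<in> subjet f x"
proof -
  define \<theta> where "\<theta> y = z \<bullet> (y - x) + R / 2 * (h \<bullet> (y - x))\<^sup>2" for y
  define grad where "grad y = z + (R * (h \<bullet> (y - x))) *\<^sub>R h" for y
  have "C2_with \<theta> grad (\<lambda>_. R *\<^sub>R outer_square h)"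
    unfolding C2_with_def
  proof (intro conjI allI)
    fix y
    show "GDERIV \<theta> y :> grad y"
      unfolding gderiv_def \<theta>_def grad_def
      by (auto intro!: derivative_eq_intros simp: inner_add_right inner_commute)
    show "(grad has_derivative ((*v) (R *\<^sub>R outer_square h))) (at y)"
      unfolding grad_def by (auto intro!: derivative_eq_intros simp: outer_square_mult_vec)
  qed simp
  moreover obtain a where a: "f x = ereal a" using fin by auto
  have "\<forall>\<^sub>F y in nhds x. f x - ereal (\<theta> x) \<le> f y - ereal (\<theta> y)"
    using minor
  proof eventually_elim
    case (elim y)
    then show ?case by (cases "f y") (auto simp: \<theta>_def a)
  qed
  ultimately show ?thesis
    using fin unfolding subjet_def
    by (intro CollectI exI[of _ grad] exI[of _ "\<lambda>_. R *\<^sub>R outer_square h"]) (auto simp: grad_def)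
qed

text \<open>If \<open>M\<close> were not strongly monotone along \<open>U\<close>, the potential \<open>\<phi>\<close> would be touched from above by
  ever flatter parabolas in directions converging to some \<open>h \<in> U\<close>; dually \<open>f\<close> is then touched from
  below with second order part \<open>R h h\<^sup>T\<close> for arbitrarily large \<open>R\<close>.\<close>

lemma strongly_monotone_along:
  fixes f :: "real^'n \<Rightarrow> ereal"
  assumes tm: "tilted_minimisers (\<lambda>w. f (xb + w)) M e \<rho> L" and U: "subspace U"
    and fin: "\<And>h. h \<in> U \<Longrightarrow> rank1_support (lim_subhessians f xb 0) h < \<infinity>"
  shows "\<exists>c>0. \<exists>\<eta>>0. \<eta> \<le> \<rho> \<and> (\<forall>z z'. norm z < \<eta> \<and> norm z' < \<eta> \<and> z' - z \<in> U \<longrightarrow>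
    c * (norm (z' - z))\<^sup>2 \<le> (M z' - M z) \<bullet> (z' - z))"
proof (rule ccontr)
  assume contra: "\<not> ?thesis"
  interpret tilted_minimisers "\<lambda>w. f (xb + w)" M e \<rho> L by (rule tm)
  \<comment> \<open>The three bounds keep tilts in the domain of \<open>\<phi>\<close>, keep
    \<open>M z\<close> strictly inside the ball of radius \<open>e\<close>, and drive the tilts to
    0.\<close>
  define \<eta> where "\<eta> k = min (min \<rho> (e / (L + 1))) (1 / (real k + 1))" for k
  have \<eta>_pos: "\<eta> k > 0" for k
    using \<rho>_pos e_pos L_nonneg by (simp add: \<eta>_def)
  have "\<exists>z h. norm z < \<eta> k \<and> norm h = 1 \<and> h \<in> U \<and>
    (\<forall>R. R \<le> real k + 1 \<longrightarrow> (z, R *\<^sub>R outer_square h) \<in> subjet f (xb + M z))" for k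
  proof -
    have \<eta>\<rho>: "\<eta> k \<le> \<rho>" by (simp add: \<eta>_def)
    \<comment> \<open>The negated claim, for the constant \<open>1 / (real k + 1)\<close> and the
      radius \<open>\<eta> k\<close>.\<close>
    obtain z0 z1 where z: "norm z0 < \<eta> k" "norm z1 < \<eta> k" "z1 - z0 \<in> U"
      and lt: "(M z1 - M z0) \<bullet> (z1 - z0) < 1 / (real k + 1) * (norm (z1 - z0))\<^sup>2"
      using contra \<eta>_pos \<eta>\<rho>
      by (metis not_le zero_less_divide_1_iff add.commute of_nat_0_less_iff of_nat_Suc zero_less_Suc)
    define T where "T = norm (z1 - z0)"
    define h where "h = (z1 - z0) /\<^sub>R T"
    have "z1 \<noteq> z0" using lt by auto
    then have T: "T > 0" by (simp add: T_def)
    have h: "norm h = 1" "h \<in> U"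
      using T z U by (auto simp: h_def T_def subspace_scale)
    have z1: "z1 = z0 + T *\<^sub>R h" using T by (simp add: h_def)
    have seg: "norm (z0 + t *\<^sub>R h) < \<eta> k" if "0 \<le> t" "t \<le> T" for t
    proof -
      have "z0 + t *\<^sub>R h = (1 - t / T) *\<^sub>R z0 + (t / T) *\<^sub>R z1"
        using T by (simp add: z1 algebra_simps)
      moreover have "\<dots> \<in> ball 0 (\<eta> k)"
        using z that T by (intro convexD) auto
      ultimately show ?thesis by simp
    qed
    have der: "DERIV (\<lambda>t. \<phi> (z0 + t *\<^sub>R h)) t :> M (z0 + t *\<^sub>R h) \<bullet> h" if "0 \<le> t" "t \<le> T" for t
    proof -
      have "((\<lambda>t. z0 + t *\<^sub>R h) has_derivative (\<lambda>t. t *\<^sub>R h)) (at t)"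
        by (auto intro!: derivative_eq_intros)
      moreover have "(\<phi> has_derivative (\<lambda>d. M (z0 + t *\<^sub>R h) \<bullet> d)) (at (z0 + t *\<^sub>R h))"
        using seg[OF that] \<eta>\<rho> by (intro \<phi>_has_derivative) simp
      ultimately have "((\<lambda>t. \<phi> (z0 + t *\<^sub>R h)) has_derivative (\<lambda>s. M (z0 + t *\<^sub>R h) \<bullet> (s *\<^sub>R h))) (at t)"
        by (rule has_derivative_compose)
      moreover have "(\<lambda>s. M (z0 + t *\<^sub>R h) \<bullet> (s *\<^sub>R h)) = (*) (M (z0 + t *\<^sub>R h) \<bullet> h)"
        by (auto simp: mult.commute)
      ultimately show ?thesis
        by (simp add: has_field_derivative_def)
    qed
    have "M (z0 + T *\<^sub>R h) \<bullet> h - M (z0 + 0 *\<^sub>R h) \<bullet> h < 1 / (real k + 1) * T"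
    proof -
      have "z1 - z0 = T *\<^sub>R h" by (simp add: z1)
      then have "T * ((M z1 - M z0) \<bullet> h) < T * (1 / (real k + 1) * T)"
        using lt T h by (simp add: power2_eq_square algebra_simps)
      then have "(M z1 - M z0) \<bullet> h < 1 / (real k + 1) * T"
        using T mult_less_cancel_left_pos by blast
      then show ?thesis by (simp add: z1 inner_diff_left)
    qed
    from parabola_touches_above[of T "\<lambda>t. \<phi> (z0 + t *\<^sub>R h)" "\<lambda>t. M (z0 + t *\<^sub>R h) \<bullet> h", OF T der this]
    obtain t \<sigma> where t: "0 < t" "t < T" and \<sigma>: "\<sigma> > 0"
      and touch: "\<And>s. \<bar>s\<bar> < \<sigma> \<Longrightarrow> \<phi> (z0 + (t + s) *\<^sub>R h) \<le>
        \<phi> (z0 + t *\<^sub>R h) + s * (M (z0 + t *\<^sub>R h) \<bullet> h) + 1 / (real k + 1) / 2 * s\<^sup>2"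
      by metis
    define z where "z = z0 + t *\<^sub>R h"
    have z\<eta>: "norm z < \<eta> k" unfolding z_def by (rule seg) (use t in auto)
    then have z\<rho>: "norm z < \<rho>" using \<eta>\<rho> by simp
    have "norm z < e / (L + 1)" using z\<eta> by (simp add: \<eta>_def)
    then have "norm z * (L + 1) < e" using L_nonneg by (simp add: pos_less_divide_eq)
    then have Mz: "norm (M z) < e"
      using norm_M_le[OF z\<rho>] norm_ge_zero[of z] by (simp only: ring_distribs mult.commute[of L])
    have "(z, R *\<^sub>R outer_square h) \<in> subjet f (xb + M z)" if R: "R \<le> real k + 1" for R
    proof (rule outer_square_mem_subjet)
      show "\<bar>f (xb + M z)\<bar> \<noteq> \<infinity>" using F_finite[OF z\<rho>] .
      have "\<forall>\<^sub>F w in nhds (M z). f (xb + M z) + ereal (z \<bullet> (w - M z) + R / 2 * (h \<bullet> (w - M z))\<^sup>2) \<le> f (xb + w)"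
      proof (rule quadratic_minorant_of_touching[OF z\<rho> Mz h(1) _ \<sigma>])
        show "1 / (real k + 1) > 0" by simp
        show "R * (1 / (real k + 1)) \<le> 1" using R by (simp add: field_simps)
        show "\<phi> (z + s *\<^sub>R h) \<le> \<phi> z + s * (M z \<bullet> h) + 1 / (real k + 1) / 2 * s\<^sup>2" if "\<bar>s\<bar> < \<sigma>" for s
          using touch[OF that] by (simp add: z_def algebra_simps)
      qed
      then have "\<forall>\<^sub>F w in filtermap (\<lambda>y. y - xb) (nhds (xb + M z)).
          f (xb + M z) + ereal (z \<bullet> (w - M z) + R / 2 * (h \<bullet> (w - M z))\<^sup>2) \<le> f (xb + w)"
        using filtermap_nhds_shift[of xb "xb + M z"] by simp
      then show "\<forall>\<^sub>F y in nhds (xb + M z). f (xb + M z) + ereal (z \<bullet> (y - (xb + M z)) +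
          R / 2 * (h \<bullet> (y - (xb + M z)))\<^sup>2) \<le> f y"
        by (simp add: eventually_filtermap algebra_simps)
    qed
    then show ?thesis using z\<eta> h by blast
  qed
  then obtain Z H where Z: "\<And>k. norm (Z k) < \<eta> k" and H: "\<And>k. norm (H k) = 1" "\<And>k. H k \<in> U"
    and jet: "\<And>k R. R \<le> real k + 1 \<Longrightarrow> (Z k, R *\<^sub>R outer_square (H k)) \<in> subjet f (xb + M (Z k))"
    by metis
  have "compact (U \<inter> sphere 0 1)"
    by (intro closed_Int_compact closed_subspace U) auto
  moreover have "\<forall>k. H k \<in> U \<inter> sphere 0 1" using H by auto
  ultimately obtain h r where h: "h \<in> U \<inter> sphere 0 1" and r: "strict_mono r" and lim: "(H \<circ> r) \<longlonglongrightarrow> h"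
    unfolding compact_def by blast
  have Z0: "Z \<longlonglongrightarrow> 0"
  proof (rule tendsto_norm_zero_cancel, rule tendsto_sandwich[of "\<lambda>_. 0" _ _ "\<lambda>k. 1 / (real k + 1)"])
    show "(\<lambda>k. 1 / (real k + 1)) \<longlonglongrightarrow> 0"
      using LIMSEQ_inverse_real_of_nat by (simp add: inverse_eq_divide add.commute)
    show "\<forall>\<^sub>F k in sequentially. norm (Z k) \<le> 1 / (real k + 1)"
      using Z by (intro always_eventually) (auto simp: \<eta>_def intro: less_imp_le)
  qed auto
  have \<rho>Z: "norm (Z k) < \<rho>" for k using Z[of k] by (simp add: \<eta>_def)
  have "ereal (real N) \<le> rank1_support (lim_subhessians f xb 0) h" for N
  proof -
    \<comment> \<open>The shift gives \<open>q k \<ge> N\<close>, so curvature \<open>N\<close> is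
      available along the whole subsequence; the limiting subhessian N h h^T then has the value N at
      the unit vector \<open>h\<close>.\<close>
    define q where "q k = r (k + N)" for k
    have q: "strict_mono q" using r by (auto simp: q_def strict_mono_def)
    have qN: "real N \<le> real (q k) + 1" for k
      using seq_suble[OF r, of "k + N"] by (simp add: q_def)
    have Zq: "(\<lambda>k. Z (q k)) \<longlonglongrightarrow> 0"
      using LIMSEQ_subseq_LIMSEQ[OF Z0 q] by (simp add: o_def)
    have isM: "isCont M 0"
    proof -
      have "continuous_on (ball 0 \<rho>) M"
        using M_lipschitz by (rule lipschitz_on_continuous_on)
      then show ?thesis using \<rho>_pos by (simp add: continuous_on_eq_continuous_at)
    qed
    have Mq: "(\<lambda>k. M (Z (q k))) \<longlonglongrightarrow> 0"
      using isCont_tendsto_compose[OF isM Zq] by (simp add: M_zero)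
    have "isCont \<phi> 0"
      using \<phi>_continuous \<rho>_pos by (simp add: continuous_on_eq_continuous_at)
    then have \<phi>q: "(\<lambda>k. \<phi> (Z (q k))) \<longlonglongrightarrow> \<phi> 0"
      using isCont_tendsto_compose[OF _ Zq] by blast
    have "(\<lambda>k. ereal (Z (q k) \<bullet> M (Z (q k)) - \<phi> (Z (q k)))) \<longlonglongrightarrow> ereal (0 \<bullet> (0::real^'n) - \<phi> 0)"
      by (intro tendsto_intros Zq Mq \<phi>q)
    then have fq: "(\<lambda>k. f (xb + M (Z (q k)))) \<longlonglongrightarrow> f xb"
      using F_M[OF \<rho>Z] F_M[of 0] \<rho>_pos M_zero by simp
    have "f_converges f (\<lambda>k. xb + M (Z (q k))) xb"
      unfolding f_converges_def using fq tendsto_add[OF tendsto_const Mq, of xb] by simp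
    moreover have "(\<lambda>k. real N *\<^sub>R outer_square (H (q k))) \<longlonglongrightarrow> real N *\<^sub>R outer_square h"
    proof (rule tendsto_outer_square)
      have "(\<lambda>k. (H \<circ> r) (k + N)) \<longlonglongrightarrow> h" by (rule LIMSEQ_ignore_initial_segment[OF lim])
      then show "(\<lambda>k. H (q k)) \<longlonglongrightarrow> h" by (simp add: q_def)
    qed
    ultimately have "(0, real N *\<^sub>R outer_square h) \<in> lim_subjet f xb"
      unfolding lim_subjet_def mem_Collect_eq case_prod_conv using jet[OF qN] Zq
      by (intro exI[of _ "\<lambda>k. xb + M (Z (q k))"] exI[of _ "\<lambda>k. Z (q k)"]
          exI[of _ "\<lambda>k. real N *\<^sub>R outer_square (H (q k))"]) simp
    then have "real N *\<^sub>R outer_square h \<in> lim_subhessians f xb 0"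
      by (simp add: lim_subhessians_def transpose_outer_square)
    then have "ereal (((real N *\<^sub>R outer_square h) *v h) \<bullet> h) \<le> rank1_support (lim_subhessians f xb 0) h"
      unfolding rank1_support_def by (rule SUP_upper)
    then show ?thesis
      using h by (simp add: outer_square_mult_vec dot_square_norm)
  qed
  then have "rank1_support (lim_subhessians f xb 0) h = \<infinity>"
    by (intro ereal_top) (meson ereal_less_eq(3) order_trans real_arch_simple)
  then show False using fin[of h] h by simp
qed

section \<open>Orthogonal projections and closed convex hulls\<close>

lemma closest_point_eq_orthogonal_projection:
  fixes S :: "'a::euclidean_space set"
  assumes S: "subspace S" and y: "y \<in> S" and orth: "\<And>d. d \<in> S \<Longrightarrow> (x - y) \<bullet> d = 0"
  shows "closest_point S x = y"
proof (rule closest_point_unique[symmetric])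
  show "\<forall>z\<in>S. dist x y \<le> dist x z"
  proof
    fix z assume "z \<in> S"
    then have "(x - y) \<bullet> (y - z) = 0" using orth S y by (simp add: subspace_diff)
    then have "(norm (x - z))\<^sup>2 = (norm (x - y))\<^sup>2 + (norm (y - z))\<^sup>2"
      using norm_add_Pythagorean[of "x - y" "y - z"] by (simp add: orthogonal_def)
    then show "dist x y \<le> dist x z"
      unfolding dist_norm by (intro power2_le_imp_le[OF _ norm_ge_zero]) simp
  qed
qed (use S y closed_subspace subspace_imp_convex in auto)

lemma linear_closest_point:
  fixes S :: "'a::euclidean_space set"
  assumes S: "subspace S"
  shows "linear (closest_point S)"
proof -
  have ex: "\<exists>y\<in>S. \<forall>d\<in>S. (x - y) \<bullet> d = 0" for x
    using orthogonal_subspace_decomp_exists[of S x] span_eq_iff[THEN iffD2, OF S]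
    by (metis add_diff_cancel_left' orthogonal_def)
  have cp: "closest_point S x \<in> S" "\<forall>d\<in>S. (x - closest_point S x) \<bullet> d = 0" for x
    using ex[of x] closest_point_eq_orthogonal_projection[OF S, of _ x] by metis+
  show ?thesis
  proof (rule linearI)
    fix x y
    show "closest_point S (x + y) = closest_point S x + closest_point S y"
      using cp[of x] cp[of y] S
      by (intro closest_point_eq_orthogonal_projection)
        (auto simp: subspace_add inner_add_left inner_diff_left)
    fix r
    show "closest_point S (r *\<^sub>R x) = r *\<^sub>R closest_point S x"
      using cp[of x] S
      by (intro closest_point_eq_orthogonal_projection)
        (auto simp: subspace_scale inner_diff_left)
  qed
qed

text \<open>The points above the affine function form a closed half-space, which contains the closed
  convex hull of \<open>epi h\<close> as soon as it contains \<open>epi h\<close>.\<close>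

lemma co_ge_affine:
  fixes h :: "'a::euclidean_space \<Rightarrow> ereal"
  assumes "\<And>w. ereal (q \<bullet> w - b) \<le> h w"
  shows "ereal (q \<bullet> w - b) \<le> co h w"
proof -
  let ?H = "{x :: 'a \<times> real. (q, -1) \<bullet> x \<le> b}"
  have "epi h \<subseteq> ?H"
  proof
    fix x assume "x \<in> epi h"
    then have "ereal (q \<bullet> fst x - b) \<le> ereal (snd x)"
      using assms[of "fst x"] order_trans by (fastforce simp: epi_def split_beta simp del: ereal_less_eq)
    then show "x \<in> ?H" by (cases x) simp
  qed
  then have "closure (convex hull (epi h)) \<subseteq> ?H"
    by (intro closure_minimal hull_minimal closed_halfspace_le convex_halfspace_le)
  then show ?thesis
    unfolding co_def by (intro Inf_greatest) force
qed

lemma co_le: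
  assumes "h w = ereal a"
  shows "co h w \<le> ereal a"
proof -
  have "(w, a) \<in> closure (convex hull (epi h))"
    using assms closure_subset hull_subset by (fastforce simp: epi_def)
  then show ?thesis unfolding co_def by (intro Inf_lower) auto
qed

section \<open>Solving for the minimiser above a given point of U\<close>

text \<open>On one common radius, \<open>M_V\<close> records the outcome of prox-regularity and
  \<open>M_strong_mono\<close> that of the second-order condition. Monotonicity is strong only along
  \<open>V\<^sup>\<bottom>\<close>, since \<open>M\<close> vanishes on \<open>V\<close> near
  0.\<close>

locale VU_tilted = tilted_minimisers +
  fixes V :: "'a set" and c :: real
  assumes V: "subspace V" and c_pos: "0 < c"
    and M_V: "\<And>z. z \<in> V \<Longrightarrow> norm z < \<rho> \<Longrightarrow> M z = 0"
    and M_strong_mono: "\<And>z z'. norm z < \<rho> \<Longrightarrow> norm z' < \<rho> \<Longrightarrow> z' - z \<in> V\<^sup>\<bottom> \<Longrightarrow>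
      c * (norm (z' - z))\<^sup>2 \<le> (M z' - M z) \<bullet> (z' - z)"
begin

abbreviation U :: "'a set" where "U \<equiv> V\<^sup>\<bottom>"

lemma subspace_U: "subspace U"
  by (rule subspace_orthogonal_comp)

lemma UV_orth: "u \<in> U \<Longrightarrow> v \<in> V \<Longrightarrow> u \<bullet> v = 0" "u \<in> U \<Longrightarrow> v \<in> V \<Longrightarrow> v \<bullet> u = 0"
  by (auto simp: orthogonal_comp_def orthogonal_def inner_commute)

lemma mem_V_iff: "x \<in> V \<longleftrightarrow> (\<forall>u\<in>U. x \<bullet> u = 0)"
  using orthogonal_comp_self[OF V] UV_orth
  by (auto simp: orthogonal_comp_def[of U] orthogonal_def inner_commute set_eq_iff)

lemma UV_decomp: obtains u v where "u \<in> U" "v \<in> V" "x = u + v"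
  using subspace_sum_orthogonal_comp[OF V] by (metis UNIV_I add.commute set_plus_elim)

lemma \<phi>_V: "z \<in> V \<Longrightarrow> norm z < \<rho> \<Longrightarrow> \<phi> z = \<phi> 0"
  using M_V[of z] M_zero by (simp add: \<phi>_def)

text \<open>\<open>p\<close> minimises \<open>\<phi> (q + z) - u \<bullet> q\<close> over a ball of
  \<open>U\<close>; criticality says that \<open>M (p + z) - u\<close> is orthogonal to
  \<open>U\<close>. Strong monotonicity bounds \<open>p\<close>, and minorants with slopes in
  \<open>V\<close> bound the \<open>V\<close>-part.\<close>

lemma tilt_solution_exists:
  assumes z: "z \<in> V" "norm z \<le> \<rho> / 4" and u: "u \<in> U" "norm u < c * \<rho> / 16"
  shows "\<exists>p\<in>U. norm p \<le> norm u / c \<and> M (p + z) - u \<in> V \<and> norm (M (p + z) - u) \<le> norm u"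
proof -
  define s where "s = \<rho> / 4"
  define \<Psi> where "\<Psi> q = \<phi> (q + z) - u \<bullet> q" for q
  have s: "s > 0" using \<rho>_pos by (simp add: s_def)
  have qz: "norm (q + z) < \<rho>" if "norm q \<le> s" for q
    using that z norm_triangle_ineq[of q z] \<rho>_pos by (simp add: s_def)
  have z\<rho>: "norm z < \<rho>" using z \<rho>_pos by simp
  have "continuous_on (U \<inter> cball 0 s) \<Psi>"
    unfolding \<Psi>_def
    by (intro continuous_intros continuous_on_compose2[OF \<phi>_continuous]) (use qz in auto)
  moreover have "compact (U \<inter> cball 0 s)"
    by (intro closed_Int_compact closed_subspace subspace_U) auto
  moreover have "0 \<in> U \<inter> cball 0 s" using subspace_0[OF subspace_U] s by simp
  ultimately obtain p where p: "p \<in> U" "norm p \<le> s"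
    and min: "\<And>q. q \<in> U \<Longrightarrow> norm q \<le> s \<Longrightarrow> \<Psi> p \<le> \<Psi> q"
    using continuous_attains_inf[of "U \<inter> cball 0 s" \<Psi>] by (metis (no_types, lifting) IntD1 IntD2 IntI empty_iff mem_cball_0)
  have "norm p \<noteq> s"
  proof
    assume ps: "norm p = s"
    \<comment> \<open>The midpoint turns monotonicity into growth: \<open>\<Psi> p\<close> is at
      least \<Psi> 0 + c s^2/4 - |u| s, so minimality would force |u| \<ge> c s / 4 = c \<rho> /
      16.\<close>
    define q where "q = (1 / 2) *\<^sub>R p"
    have q: "norm q \<le> s" "q \<in> U" using ps s p subspace_U by (auto simp: q_def subspace_scale)
    have "c * (norm q)\<^sup>2 \<le> M (q + z) \<bullet> q"
      using M_strong_mono[of z "q + z"] z\<rho> qz[OF q(1)] q M_V[OF z(1) z\<rho>] by simp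
    moreover have "\<phi> (p + z) \<ge> \<phi> (q + z) + M (q + z) \<bullet> q"
      using \<phi>_subgradient[OF qz[OF q(1)] qz[OF p(2)]] by (simp add: q_def algebra_simps flip: scaleR_left_distrib)
    moreover have "\<phi> (q + z) \<ge> \<phi> z"
      using \<phi>_subgradient[OF z\<rho> qz[OF q(1)]] M_V[OF z(1) z\<rho>] by simp
    moreover have "\<phi> (p + z) - u \<bullet> p \<le> \<phi> z"
      using min[of 0] subspace_0[OF subspace_U] s by (simp add: \<Psi>_def)
    moreover have "u \<bullet> p \<le> norm u * norm p" by (rule norm_cauchy_schwarz)
    ultimately have "c * (norm q)\<^sup>2 \<le> norm u * norm p" by linarith
    then have "(c * s / 4) * s \<le> norm u * s"
      by (simp add: q_def ps power2_eq_square)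
    then have "c * s / 4 \<le> norm u" using s by simp
    then show False using u by (simp add: s_def)
  qed
  then have ps: "norm p < s" using p by simp
  have p\<rho>: "norm (p + z) < \<rho>" using qz p by simp
  have der: "(\<Psi> has_derivative (\<lambda>d. M (p + z) \<bullet> d - u \<bullet> d)) (at p)"
  proof -
    have "((\<lambda>q. q + z) has_derivative (\<lambda>d. d)) (at p)"
      by (auto intro!: derivative_eq_intros)
    from has_derivative_compose[OF this \<phi>_has_derivative[OF p\<rho>]]
    show ?thesis unfolding \<Psi>_def by (intro derivative_intros)
  qed
  have "M (p + z) \<bullet> d - u \<bullet> d = 0" if "d \<in> U" for d
    by (rule derivative_zero_of_min_on_subspace_ball[OF subspace_U p(1) ps that der min])
  then have crit: "M (p + z) - u \<in> V" by (simp add: mem_V_iff inner_diff_left)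
  define v where "v = M (p + z) - u"
  have Mp: "M (p + z) = u + v" by (simp add: v_def)
  have v: "v \<in> V" using crit by (simp add: v_def)
  have "c * (norm p)\<^sup>2 \<le> M (p + z) \<bullet> p"
    using M_strong_mono[of z "p + z"] z\<rho> p\<rho> p M_V[OF z(1) z\<rho>] by simp
  also have "\<dots> = u \<bullet> p" using v p UV_orth by (simp add: Mp inner_add_left)
  also have "\<dots> \<le> norm u * norm p" by (rule norm_cauchy_schwarz)
  finally have "norm p * (c * norm p) \<le> norm p * norm u" by (simp add: power2_eq_square algebra_simps)
  then have "c * norm p \<le> norm u" by (cases "norm p = 0") auto
  then have pu: "norm p \<le> norm u / c" using c_pos by (simp add: field_simps)
  have "norm v \<le> norm u"
  proof (cases "v = 0")
    case False
    \<comment> \<open>This tilt lies in \<open>V\<close>, where \<open>\<phi>\<close> equals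
      \<open>\<phi> 0\<close>. Its minorant grows with rate \<open>\<rho> / 2\<close> in |v|, which
      beats the rate of at most \<open>\<rho> / 4\<close> coming from \<open>z\<close>.\<close>
    define z' where "z' = (\<rho> / 2 / norm v) *\<^sub>R v"
    have z': "z' \<in> V" "norm z' < \<rho>" "z' \<bullet> (u + v) = \<rho> / 2 * norm v"
      using False v V u UV_orth \<rho>_pos
      by (auto simp: z'_def subspace_scale inner_add_right power2_eq_square dot_square_norm)
    have "ereal (z' \<bullet> (u + v) - \<phi> z') \<le> ereal ((p + z) \<bullet> (u + v) - \<phi> (p + z))"
      using fenchel[OF z'(2) M_mem[OF p\<rho>]] F_M[OF p\<rho>] by (simp add: Mp)
    then have "\<rho> / 2 * norm v - \<phi> 0 \<le> (p \<bullet> u + z \<bullet> v) - \<phi> (p + z)"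
      using z' \<phi>_V UV_orth p v z u by (simp add: inner_add_left inner_add_right)
    then have "\<rho> / 2 * norm v \<le> p \<bullet> u + z \<bullet> v"
      using \<phi>_ge[OF p\<rho>] by simp
    also have "\<dots> \<le> norm p * norm u + norm z * norm v"
      by (intro add_mono norm_cauchy_schwarz)
    also have "\<dots> \<le> norm u / c * norm u + \<rho> / 4 * norm v"
      using pu z by (intro add_mono mult_right_mono) auto
    finally have "\<rho> / 4 * norm v \<le> norm u / c * norm u" by linarith
    also have "\<dots> \<le> \<rho> / 16 * norm u"
      using u c_pos by (intro mult_right_mono) (auto simp: field_simps)
    finally have "\<rho> * (4 * norm v) \<le> \<rho> * norm u" by simp
    then have "4 * norm v \<le> norm u" using \<rho>_pos by (simp only: mult_le_cancel_left_pos)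
    then show ?thesis using norm_ge_zero[of v] by linarith
  qed simp
  then show ?thesis using p pu crit by (auto simp: v_def)
qed

text \<open>For a tilt \<open>z \<in> V\<close>, \<open>tilt z u\<close> is the \<open>U\<close>-component of the tilt whose minimiser lies above \<open>u\<close>,
  \<open>vpart z u\<close> the \<open>V\<close>-component of that minimiser, and \<open>kval z u\<close> the resulting value of
  \<open>F (u + \<cdot>) - \<langle>z, \<cdot>\<rangle>\<close>.\<close>

definition tilt :: "'a \<Rightarrow> 'a \<Rightarrow> 'a" where
  "tilt z u = (SOME p. p \<in> U \<and> norm p \<le> norm u / c \<and> M (p + z) - u \<in> V \<and> norm (M (p + z) - u) \<le> norm u)"

definition vpart :: "'a \<Rightarrow> 'a \<Rightarrow> 'a" where
  "vpart z u = M (tilt z u + z) - u"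

definition kval :: "'a \<Rightarrow> 'a \<Rightarrow> real" where
  "kval z u = tilt z u \<bullet> u - \<phi> (tilt z u + z)"

context
  fixes z u
  assumes z: "z \<in> V" "norm z \<le> \<rho> / 4" and u: "u \<in> U" "norm u < c * \<rho> / 16"
begin

lemma tilt_props:
  shows tilt_U: "tilt z u \<in> U" and vpart_V: "vpart z u \<in> V"
    and norm_tilt: "norm (tilt z u + z) < \<rho>" and norm_vpart: "norm (vpart z u) \<le> norm u"
    and M_tilt: "M (tilt z u + z) = u + vpart z u"
proof -
  have "\<exists>p. p \<in> U \<and> norm p \<le> norm u / c \<and> M (p + z) - u \<in> V \<and> norm (M (p + z) - u) \<le> norm u"
    using tilt_solution_exists[OF z u] by (simp only: Bex_def)
  from someI_ex[OF this] have *: "tilt z u \<in> U" "norm (tilt z u) \<le> norm u / c"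
    "M (tilt z u + z) - u \<in> V" "norm (M (tilt z u + z) - u) \<le> norm u"
    unfolding tilt_def by simp_all
  have "norm u / c < \<rho> / 16" using u c_pos by (simp add: field_simps)
  then have "norm (tilt z u) < \<rho> / 16" using *(2) by linarith
  then show "norm (tilt z u + z) < \<rho>"
    using norm_triangle_ineq[of "tilt z u" z] z \<rho>_pos by linarith
  show "tilt z u \<in> U" "vpart z u \<in> V" "norm (vpart z u) \<le> norm u" "M (tilt z u + z) = u + vpart z u"
    using * by (simp_all add: vpart_def)
qed

lemma F_graph: "F (u + vpart z u) = ereal (z \<bullet> vpart z u + kval z u)"
  using F_M[OF norm_tilt] UV_orth(1)[OF tilt_U vpart_V] UV_orth(2)[OF u(1) z(1)]
  by (simp add: M_tilt kval_def inner_add_left inner_add_right)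

text \<open>Fenchel's inequality for the slope \<open>tilt z u + z\<close>, split along
  \<open>U\<close> and \<open>V\<close>; by \<open>F_graph\<close> it is sharp at
  \<open>u' = u\<close>, \<open>v' = vpart z u\<close>.\<close>

lemma kval_minorant:
  assumes "u' \<in> U" "v' \<in> V" "norm (u' + v') \<le> e"
  shows "ereal (kval z u + tilt z u \<bullet> (u' - u) + z \<bullet> v') \<le> F (u' + v')"
  using fenchel[OF norm_tilt assms(3)] UV_orth(1)[OF tilt_U assms(2)] UV_orth(2)[OF assms(1) z(1)]
  by (simp add: kval_def inner_add_left inner_add_right inner_diff_right algebra_simps)

end

context
  fixes z u u'
  assumes z: "z \<in> V" "norm z \<le> \<rho> / 4" and u: "u \<in> U" "norm u < c * \<rho> / 16"
    and u': "u' \<in> U" "norm u' < c * \<rho> / 16"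
begin

text \<open>The subgradient inequality of \<open>\<phi>\<close> with point and slope exchanged; the
  \<open>V\<close>-part drops out because the tilts differ by a vector of \<open>U\<close>. Together
  with \<open>tilt_dist\<close> it makes \<open>tilt z\<close> the gradient of
  \<open>kval z\<close>.\<close>

lemma kval_subgradient: "kval z u' \<ge> kval z u + tilt z u \<bullet> (u' - u)"
proof -
  have "\<phi> (tilt z u + z) \<ge> \<phi> (tilt z u' + z) + (u' + vpart z u') \<bullet> (tilt z u - tilt z u')"
    using \<phi>_subgradient[OF norm_tilt[OF z u'] norm_tilt[OF z u]] by (simp add: M_tilt[OF z u'])
  moreover have "vpart z u' \<bullet> (tilt z u - tilt z u') = 0"
    using UV_orth(2) vpart_V[OF z u'] tilt_U[OF z u] tilt_U[OF z u'] subspace_U by (simp add: subspace_diff)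
  ultimately show ?thesis
    by (simp add: kval_def inner_add_left inner_diff_right inner_commute[of u'] inner_commute[of u])
qed

text \<open>Strong monotonicity inverted: paired with a vector of \<open>U\<close>, the difference
  of the two minimisers reduces to \<open>u - u'\<close>.\<close>

lemma tilt_dist: "norm (tilt z u - tilt z u') \<le> norm (u - u') / c"
proof -
  let ?d = "tilt z u - tilt z u'"
  have d: "?d \<in> U" using tilt_U[OF z u] tilt_U[OF z u'] subspace_U by (simp add: subspace_diff)
  have "c * (norm ?d)\<^sup>2 \<le> (M (tilt z u + z) - M (tilt z u' + z)) \<bullet> ?d"
    using M_strong_mono[OF norm_tilt[OF z u'] norm_tilt[OF z u]] d by simp
  also have "\<dots> = (u - u') \<bullet> ?d"
    using UV_orth(2)[OF d] vpart_V[OF z u] vpart_V[OF z u']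
    by (simp add: M_tilt[OF z u] M_tilt[OF z u'] inner_add_left inner_diff_left)
  also have "\<dots> \<le> norm (u - u') * norm ?d" by (rule norm_cauchy_schwarz)
  finally have "norm ?d * (c * norm ?d) \<le> norm ?d * norm (u - u')" by (simp add: power2_eq_square algebra_simps)
  then have "c * norm ?d \<le> norm (u - u')" by (cases "norm ?d = 0") auto
  then show ?thesis using c_pos by (simp add: field_simps)
qed

end

lemma tilt_lipschitz:
  assumes z: "z \<in> V" "norm z \<le> \<rho> / 4" and \<epsilon>: "\<epsilon> < c * \<rho> / 16"
  shows "(1 / c)-lipschitz_on (U \<inter> cball 0 \<epsilon>) (tilt z)"
proof (rule lipschitz_onI)
  fix x y assume xy: "x \<in> U \<inter> cball 0 \<epsilon>" "y \<in> U \<inter> cball 0 \<epsilon>"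
  then have "norm x < c * \<rho> / 16" "norm y < c * \<rho> / 16" using \<epsilon> by auto
  then have "norm (tilt z x - tilt z y) \<le> norm (x - y) / c"
    using tilt_dist[OF z] xy by blast
  then show "dist (tilt z x) (tilt z y) \<le> 1 / c * dist x y"
    by (simp add: dist_norm)
qed (use c_pos in simp)

lemma kval_has_derivative:
  assumes z: "z \<in> V" "norm z \<le> \<rho> / 4" and \<epsilon>: "\<epsilon> < c * \<rho> / 16" and u: "u \<in> U \<inter> cball 0 \<epsilon>"
  shows "(kval z has_derivative (\<lambda>d. tilt z u \<bullet> d)) (at u within U \<inter> cball 0 \<epsilon>)"
proof (rule has_derivative_of_subgradient_ineq[OF _ tilt_lipschitz[OF z \<epsilon>] u])
  fix x y assume xy: "x \<in> U \<inter> cball 0 \<epsilon>" "y \<in> U \<inter> cball 0 \<epsilon>"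
  then have "norm x < c * \<rho> / 16" "norm y < c * \<rho> / 16" using \<epsilon> by auto
  then show "kval z x + tilt z x \<bullet> (y - x) \<le> kval z y"
    using kval_subgradient[OF z] xy by blast
qed

end

section \<open>The convexified function g and its minimisers along V\<close>

context VU_tilted
begin

context
  fixes \<epsilon> :: real
  assumes \<epsilon>_pos: "0 < \<epsilon>" and \<epsilon>_small: "\<epsilon> < c * \<rho> / 16" and \<epsilon>_e: "2 * \<epsilon> \<le> e"
begin

definition UV_box :: "'a set" where
  "UV_box = {u + v |u v. u \<in> U \<inter> cball 0 \<epsilon> \<and> v \<in> V \<inter> cball 0 \<epsilon>}"

definition g :: "'a \<Rightarrow> ereal" where
  "g = co (\<lambda>w. F w + indicator_infty UV_box w)"

lemma norm_UV_le: "norm u \<le> \<epsilon> \<Longrightarrow> norm v \<le> \<epsilon> \<Longrightarrow> norm (u + v) \<le> e"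
  using norm_triangle_ineq[of u v] \<epsilon>_e by linarith

lemma zero_V: "0 \<in> V" "norm (0::'a) \<le> \<rho> / 4"
  using subspace_0[OF V] \<rho>_pos by auto

lemma S_small: "u \<in> U \<inter> cball 0 \<epsilon> \<Longrightarrow> u \<in> U \<and> norm u < c * \<rho> / 16"
  using \<epsilon>_small by simp

text \<open>\<open>2 * \<epsilon> \<le> e\<close> puts the box inside the ball where Fenchel's
  inequality holds, and affine bounds survive the closed convex hull.\<close>

lemma g_minorant:
  assumes q: "norm q < \<rho>"
  shows "ereal (q \<bullet> w - \<phi> q) \<le> g w"
  unfolding g_def
proof (rule co_ge_affine)
  fix w
  show "ereal (q \<bullet> w - \<phi> q) \<le> F w + indicator_infty UV_box w"
  proof (cases "w \<in> UV_box")
    case True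
    then have "norm w \<le> e" using norm_UV_le by (auto simp: UV_box_def)
    from fenchel[OF q this] show ?thesis using True by (simp add: indicator_infty_def)
  next
    case False
    have "F w + \<infinity> = \<infinity>" by (cases "F w") auto
    then show ?thesis using False by (simp add: indicator_infty_def)
  qed
qed

context
  fixes u
  assumes u: "u \<in> U \<inter> cball 0 \<epsilon>"
begin

private lemma u': "u \<in> U" "norm u < c * \<rho> / 16" "norm u \<le> \<epsilon>"
  using S_small[OF u] u by auto

lemma tilt0_norm: "norm (tilt 0 u) < \<rho>"
  using norm_tilt[OF zero_V u'(1,2)] by simp

lemma vpart_mem:
  assumes "z \<in> V" "norm z \<le> \<rho> / 4"
  shows "vpart z u \<in> V \<inter> cball 0 \<epsilon>"
  using vpart_V[OF assms u'(1,2)] norm_vpart[OF assms u'(1,2)] u'(3) by simp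

lemma F_graph0: "F (u + vpart 0 u) = ereal (kval 0 u)"
  using F_graph[OF zero_V u'(1,2)] by simp

text \<open>The slope lies in \<open>U\<close> and so ignores \<open>v1\<close>. The case
  \<open>u1 = u\<close> yields minimality along \<open>V\<close>, general \<open>u1\<close> a
  subgradient of \<open>g\<close>.\<close>

lemma g_lower:
  assumes "u1 \<in> U" "v1 \<in> V"
  shows "ereal (kval 0 u + tilt 0 u \<bullet> (u1 - u)) \<le> g (u1 + v1)"
  using g_minorant[OF tilt0_norm, of "u1 + v1"] UV_orth(1)[OF tilt_U[OF zero_V u'(1,2)] assms(2)]
  by (simp add: kval_def inner_add_right inner_diff_right algebra_simps)

text \<open>Convexification cannot lower a value at which an affine minorant touches, so
  \<open>g\<close> agrees with \<open>F\<close> here.\<close>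

lemma g_graph: "g (u + vpart 0 u) = ereal (kval 0 u)"
proof (rule antisym)
  have "u + vpart 0 u \<in> UV_box" using vpart_mem[OF zero_V] u by (auto simp: UV_box_def)
  then show "g (u + vpart 0 u) \<le> ereal (kval 0 u)"
    unfolding g_def by (intro co_le) (simp add: F_graph0 indicator_infty_def)
  show "ereal (kval 0 u) \<le> g (u + vpart 0 u)"
    using g_lower[OF u'(1) vpart_V[OF zero_V u'(1,2)]] by simp
qed

text \<open>All affine minorants \<open>\<langle>q, \<cdot>\<rangle> - \<phi> q\<close> with \<open>q\<close> near \<open>p = tilt 0 u\<close> lie below \<open>g\<close>; equality for
  \<open>q = p\<close> at a point \<open>w\<close> makes \<open>p\<close> a critical point of \<open>\<phi> - \<langle>\<cdot>, w\<rangle>\<close>, hence \<open>w = M p\<close>.\<close>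

lemma g_minimiser_unique:
  assumes v: "v \<in> V" and le: "g (u + v) \<le> ereal (kval 0 u)"
  shows "v = vpart 0 u"
proof -
  define p where "p = tilt 0 u"
  define w where "w = u + v"
  define s where "s = (norm p + \<rho>) / 2"
  have p: "norm p < \<rho>" using tilt0_norm by (simp add: p_def)
  then have s: "norm p < s" "s < \<rho>" by (auto simp: s_def)
  have pw: "p \<bullet> w - \<phi> p = kval 0 u"
    using UV_orth(1)[OF tilt_U[OF zero_V u'(1,2)] v] by (simp add: p_def w_def kval_def inner_add_right)
  have der: "((\<lambda>q. \<phi> q - w \<bullet> q) has_derivative (\<lambda>d. M p \<bullet> d - w \<bullet> d)) (at p)"
    by (intro derivative_intros \<phi>_has_derivative[OF p])
  have "M p \<bullet> d - w \<bullet> d = 0" for d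
  proof (rule derivative_zero_of_min_on_subspace_ball[OF subspace_UNIV _ s(1) _ der])
    fix q :: 'a assume "norm q \<le> s"
    then have "ereal (q \<bullet> w - \<phi> q) \<le> g w" using s by (intro g_minorant) simp
    also have "\<dots> \<le> ereal (p \<bullet> w - \<phi> p)" using le by (simp add: w_def pw[unfolded w_def])
    finally show "\<phi> p - w \<bullet> p \<le> \<phi> q - w \<bullet> q" by (simp add: inner_commute)
  qed auto
  then have "(M p - w) \<bullet> (M p - w) = 0" by (simp add: inner_diff_left)
  then have "M p = w" by simp
  then show ?thesis using M_tilt[OF zero_V u'(1,2)] by (simp add: p_def w_def)
qed

text \<open>By \<open>g_lower\<close> the value \<open>kval 0 u\<close> is least, and
  \<open>g_minimiser_unique\<close> leaves one point attaining it. Every admissible selection is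
  therefore \<open>vpart 0\<close> on the ball.\<close>

lemma g_argmin: "argmin_on (V \<inter> cball 0 \<epsilon>) (\<lambda>v'. g (u + v')) = {vpart 0 u}"
proof -
  have "ereal (kval 0 u) \<le> g (u + v')" if "v' \<in> V" for v'
    using g_lower[OF u'(1) that] by simp
  moreover have "v = vpart 0 u" if "v \<in> argmin_on (V \<inter> cball 0 \<epsilon>) (\<lambda>v'. g (u + v'))" for v
  proof (rule g_minimiser_unique)
    show "v \<in> V" using that by (simp add: argmin_on_def)
    have "g (u + v) \<le> g (u + vpart 0 u)" using that vpart_mem[OF zero_V] by (simp add: argmin_on_def)
    then show "g (u + v) \<le> ereal (kval 0 u)" by (simp only: g_graph)
  qed
  ultimately show ?thesis
    using vpart_mem[OF zero_V] g_graph by (auto simp: argmin_on_def)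
qed

text \<open>This is \<open>kval_minorant\<close> at \<open>u' = u\<close>. Membership suffices: the
  common argmin in the theorem is assumed to be a singleton.\<close>

lemma vpart_argmin_tilted:
  assumes z: "z \<in> V" "norm z \<le> \<rho> / 4"
  shows "vpart z u \<in> argmin_on (V \<inter> cball 0 \<epsilon>) (\<lambda>v'. F (u + v') - ereal (z \<bullet> v'))"
proof -
  have eq: "F (u + vpart z u) - ereal (z \<bullet> vpart z u) = ereal (kval z u)"
    by (simp add: F_graph[OF z u'(1,2)])
  have "ereal (kval z u) \<le> F (u + v') - ereal (z \<bullet> v')" if "v' \<in> V \<inter> cball 0 \<epsilon>" for v'
  proof -
    have "ereal (kval z u + z \<bullet> v') \<le> F (u + v')"
      using kval_minorant[OF z u'(1,2) u'(1), of v'] norm_UV_le[OF u'(3), of v'] that by simp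
    then show ?thesis by (cases "F (u + v')") auto
  qed
  then show ?thesis using vpart_mem[OF z] by (auto simp: argmin_on_def eq)
qed

text \<open>The two tilts give two formulas for the same value of \<open>F\<close>.\<close>

lemma kval_tilt_diff:
  assumes z: "z \<in> V" "norm z \<le> \<rho> / 4" and eq: "vpart z u = vpart 0 u"
  shows "z \<bullet> vpart 0 u = kval 0 u - kval z u"
  using F_graph[OF z u'(1,2)] F_graph0 by (simp add: eq)

text \<open>Makes the subdifferential nonempty, so that the gradient formula is an equality of sets
  and not merely an inclusion.\<close>

lemma tilt_mem_convex_subdiff: "tilt 0 u \<in> convex_subdiff g (u + vpart 0 u)"
proof -
  have "g y \<ge> g (u + vpart 0 u) + ereal (tilt 0 u \<bullet> (y - (u + vpart 0 u)))" for y
  proof -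
    obtain u1 v1 where y: "u1 \<in> U" "v1 \<in> V" "y = u1 + v1" by (rule UV_decomp)
    have "tilt 0 u \<bullet> (v1 - vpart 0 u) = 0"
      using UV_orth(1)[OF tilt_U[OF zero_V u'(1,2)]] y vpart_V[OF zero_V u'(1,2)] V by (simp add: subspace_diff)
    then show ?thesis using g_lower[OF y(1,2)]
      by (simp add: g_graph y(3) inner_add_right inner_diff_right algebra_simps)
  qed
  then show ?thesis by (simp add: convex_subdiff_def g_graph)
qed

end

text \<open>For a subgradient \<open>\<zeta>\<close>, \<open>kval 0\<close> minus the affine
  function with slope \<open>\<zeta>\<close> along the graph has a minimum at \<open>u\<close>,
  whence \<open>\<zeta> \<bullet> (d + D d) = tilt 0 u \<bullet> d\<close> for
  \<open>d \<in> U\<close>. Transposed, this gives all subgradients the same image.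
  \<open>norm u < \<epsilon>\<close> allows both directions \<open>d\<close> and
  \<open>- d\<close>.\<close>

lemma VU_transpose_convex_subdiff:
  assumes u: "u \<in> U \<inter> cball 0 \<epsilon>" "norm u < \<epsilon>"
    and v: "\<And>u. u \<in> U \<inter> cball 0 \<epsilon> \<Longrightarrow> v u = vpart 0 u"
    and D: "(v has_derivative D) (at u within U \<inter> cball 0 \<epsilon>)"
  shows "VU_transpose U V D ` convex_subdiff g (u + v u) = {tilt 0 u}"
proof -
  have linD: "linear D" using D by (rule has_derivative_linear)
  have line: "((\<lambda>t. u + t *\<^sub>R d) has_derivative (\<lambda>t. t *\<^sub>R d)) (at (0::real) within T)" for d T
    by (auto intro!: derivative_eq_intros)
  have clV: "closed V" using V by (rule closed_subspace)
  have "VU_transpose U V D \<zeta> = tilt 0 u" if \<zeta>: "\<zeta> \<in> convex_subdiff g (u + v u)" for \<zeta>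
  proof -
    have key: "D d \<in> V \<and> \<zeta> \<bullet> (d + D d) = tilt 0 u \<bullet> d" if d: "d \<in> U" for d
    proof -
      define r where "r = (\<epsilon> - norm u) / (norm d + 1)"
      have r: "r > 0" using u by (simp add: r_def add_nonneg_pos)
      have mem: "u + t *\<^sub>R d \<in> U \<inter> cball 0 \<epsilon>" if "t \<in> ball 0 r" for t
      proof -
        have "\<bar>t\<bar> * (norm d + 1) < \<epsilon> - norm u"
          using that pos_less_divide_eq[of "norm d + 1" "\<bar>t\<bar>" "\<epsilon> - norm u"]
          by (simp add: r_def add_nonneg_pos)
        then have "norm u + \<bar>t\<bar> * norm d \<le> \<epsilon>" by (simp add: algebra_simps)
        then have "norm (u + t *\<^sub>R d) \<le> \<epsilon>" using norm_triangle_ineq[of u "t *\<^sub>R d"] by simp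
        then show ?thesis using u d subspace_U by (simp add: subspace_add subspace_scale)
      qed
      have sub: "(\<lambda>t. u + t *\<^sub>R d) ` ball 0 r \<subseteq> U \<inter> cball 0 \<epsilon>" using mem by blast
      have at0: "at 0 within ball 0 r = at (0::real)"
        by (rule at_within_open) (use r in auto)
      have dv: "((\<lambda>t. v (u + t *\<^sub>R d)) has_derivative (\<lambda>t. D (t *\<^sub>R d))) (at 0)"
      proof -
        have "(v has_derivative D) (at (u + 0 *\<^sub>R d) within (\<lambda>t. u + t *\<^sub>R d) ` ball 0 r)"
          using has_derivative_subset[OF D sub] by simp
        from has_derivative_in_compose[OF line this] show ?thesis by (simp add: at0)
      qed
      have dk: "((\<lambda>t. kval 0 (u + t *\<^sub>R d)) has_derivative (\<lambda>t. tilt 0 u \<bullet> (t *\<^sub>R d))) (at 0)"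
      proof -
        have "(kval 0 has_derivative (\<lambda>d. tilt 0 u \<bullet> d)) (at (u + 0 *\<^sub>R d) within (\<lambda>t. u + t *\<^sub>R d) ` ball 0 r)"
          using has_derivative_subset[OF kval_has_derivative[OF zero_V \<epsilon>_small u(1)] sub] by simp
        from has_derivative_in_compose[OF line this] show ?thesis by (simp add: at0)
      qed
      \<comment> \<open>\<open>v\<close> takes values in \<open>V\<close>, so its product with
        \<open>b\<close> vanishes near \<open>t = 0\<close> and has a trivial minimum there; hence
        \<open>D d\<close> is orthogonal to \<open>U\<close>.\<close>
      have "D (1 *\<^sub>R d) \<bullet> b = 0" if b: "b \<in> U" for b
      proof (rule derivative_zero_of_min_on_subspace_ball[OF subspace_UNIV, where p = 0 and d = 1
            and s = "r / 2" and \<Psi> = "\<lambda>t. v (u + t *\<^sub>R d) \<bullet> b" and D = "\<lambda>t. D (t *\<^sub>R d) \<bullet> b"])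
        show "((\<lambda>t. v (u + t *\<^sub>R d) \<bullet> b) has_derivative (\<lambda>t. D (t *\<^sub>R d) \<bullet> b)) (at 0)"
          by (intro derivative_intros dv)
        show "norm (0::real) < r / 2" using r by simp
        have vb: "v (u + t *\<^sub>R d) \<bullet> b = 0" if "norm t \<le> r / 2" for t
        proof -
          have t: "t \<in> ball 0 r" using that r by simp
          show ?thesis using v[OF mem[OF t]] vpart_mem[OF mem[OF t] zero_V] b UV_orth(2) by simp
        qed
        show "v (u + 0 *\<^sub>R d) \<bullet> b \<le> v (u + t *\<^sub>R d) \<bullet> b" if "norm t \<le> r / 2" for t
          using vb[OF that] vb[of 0] r by simp
      qed auto
      then have "D d \<in> V" by (simp add: mem_V_iff)
      moreover have "tilt 0 u \<bullet> (1 *\<^sub>R d) - \<zeta> \<bullet> (1 *\<^sub>R d + D (1 *\<^sub>R d)) = 0"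
      proof (rule derivative_zero_of_min_on_subspace_ball[OF subspace_UNIV, where p = 0 and d = 1
            and s = "r / 2" and \<Psi> = "\<lambda>t. kval 0 (u + t *\<^sub>R d) - \<zeta> \<bullet> (t *\<^sub>R d + v (u + t *\<^sub>R d))"
            and D = "\<lambda>t. tilt 0 u \<bullet> (t *\<^sub>R d) - \<zeta> \<bullet> (t *\<^sub>R d + D (t *\<^sub>R d))"])
        show "((\<lambda>t. kval 0 (u + t *\<^sub>R d) - \<zeta> \<bullet> (t *\<^sub>R d + v (u + t *\<^sub>R d))) has_derivative
          (\<lambda>t. tilt 0 u \<bullet> (t *\<^sub>R d) - \<zeta> \<bullet> (t *\<^sub>R d + D (t *\<^sub>R d)))) (at 0)"
          by (intro derivative_intros dv dk)
        show "norm (0::real) < r / 2" using r by simp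
        show "kval 0 (u + 0 *\<^sub>R d) - \<zeta> \<bullet> (0 *\<^sub>R d + v (u + 0 *\<^sub>R d)) \<le>
          kval 0 (u + t *\<^sub>R d) - \<zeta> \<bullet> (t *\<^sub>R d + v (u + t *\<^sub>R d))" if "norm t \<le> r / 2" for t
        proof -
          have t: "t \<in> ball 0 r" using that r by simp
          let ?u = "u + t *\<^sub>R d"
          have "g (?u + v ?u) \<ge> g (u + v u) + ereal (\<zeta> \<bullet> (?u + v ?u - (u + v u)))"
            using \<zeta> unfolding convex_subdiff_def by blast
          then have "kval 0 ?u \<ge> kval 0 u + \<zeta> \<bullet> (?u + v ?u - (u + v u))"
            by (simp add: v[OF mem[OF t]] v[OF u(1)] g_graph[OF mem[OF t]] g_graph[OF u(1)])
          then show ?thesis by (simp add: inner_add_right inner_diff_right algebra_simps)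
        qed
      qed auto
      ultimately show ?thesis by simp
    qed
    obtain \<zeta>u \<zeta>v where \<zeta>uv: "\<zeta>u \<in> U" "\<zeta>v \<in> V" "\<zeta> = \<zeta>u + \<zeta>v" by (rule UV_decomp)
    have cpU: "closest_point U (a + b) = a" if "a \<in> U" "b \<in> V" for a b
      using that UV_orth by (intro closest_point_eq_orthogonal_projection subspace_U) auto
    have cpV: "closest_point V (a + b) = b" if "a \<in> U" "b \<in> V" for a b
      using that UV_orth by (intro closest_point_eq_orthogonal_projection V) auto
    define A where "A = (\<lambda>d. D (closest_point U d))"
    have linA: "linear A"
      using linear_compose[OF linear_closest_point[OF subspace_U] linD] by (simp add: A_def o_def)
    have "x \<bullet> (\<zeta>u + adjoint A \<zeta>v - tilt 0 u) = 0" for x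
    proof -
      obtain a b where x: "a \<in> U" "b \<in> V" "x = a + b" by (rule UV_decomp)
      have Da: "D a \<in> V" "\<zeta> \<bullet> (a + D a) = tilt 0 u \<bullet> a" using key[OF x(1)] by auto
      have "x \<bullet> adjoint A \<zeta>v = D a \<bullet> \<zeta>v"
        using adjoint_works[OF linA, of x \<zeta>v] by (simp add: A_def x(3) cpU[OF x(1,2)])
      moreover have "x \<bullet> \<zeta>u = a \<bullet> \<zeta>u" "x \<bullet> tilt 0 u = a \<bullet> tilt 0 u"
        using UV_orth(2)[OF _ x(2)] \<zeta>uv(1) tilt_U[OF zero_V] S_small[OF u(1)]
        by (auto simp: x(3) inner_add_left)
      moreover have "\<zeta> \<bullet> (a + D a) = a \<bullet> \<zeta>u + D a \<bullet> \<zeta>v"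
        using UV_orth(1)[OF \<zeta>uv(1) Da(1)] UV_orth(2)[OF x(1) \<zeta>uv(2)]
        by (simp add: \<zeta>uv(3) inner_add_left inner_add_right inner_commute)
      ultimately show ?thesis
        using Da(2) by (simp add: inner_add_right inner_diff_right inner_commute[of a "tilt 0 u"])
    qed
    from this[of "\<zeta>u + adjoint A \<zeta>v - tilt 0 u"] have "\<zeta>u + adjoint A \<zeta>v - tilt 0 u = 0"
      by simp
    then show ?thesis
      by (simp add: VU_transpose_def \<zeta>uv(3) cpU[OF \<zeta>uv(1,2)] cpV[OF \<zeta>uv(1,2)] flip: A_def)
  qed
  then show ?thesis
    using tilt_mem_convex_subdiff[OF u(1)] v[OF u(1)] by force
qed

text \<open>A common minimiser for the tilts \<open>0\<close> and \<open>z = t b\<close> makes \<open>t \<langle>b, v u\<rangle>\<close> a difference of two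
  functions with Lipschitz gradients.\<close>

lemma vpart_C1:
  assumes \<tau>: "\<tau> > 0" "\<tau> \<le> \<rho> / 4"
    and common: "\<And>z u. z \<in> V \<Longrightarrow> norm z \<le> \<tau> \<Longrightarrow> u \<in> U \<inter> cball 0 \<epsilon> \<Longrightarrow> vpart z u = vpart 0 u"
  obtains D where "C1_with_derivative_on (U \<inter> cball 0 \<epsilon>) (vpart 0) D"
    "\<And>u d. blinfun_apply (D u) d \<in> V"
proof -
  let ?S = "U \<inter> cball 0 \<epsilon>"
  obtain B where B: "B \<subseteq> V" "pairwise orthogonal B" "\<And>b. b \<in> B \<Longrightarrow> norm b = 1"
    "independent B" "span B = V"
    using orthonormal_basis_subspace[OF V] by metis
  have finB: "finite B" using B by (simp add: independent_imp_finite)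
  \<comment> \<open>\<open>kval_tilt_diff\<close> with tilt \<open>\<tau> *\<^sub>R b\<close> gives
    the coordinate of \<open>vpart 0 u\<close> along \<open>b\<close>; \<open>G b\<close> is the
    gradient of that coordinate, and \<open>D\<close> assembles them over the orthonormal
    basis.\<close>
  define G where "G b u = (1 / \<tau>) *\<^sub>R (tilt 0 u - tilt (\<tau> *\<^sub>R b) u)" for b u
  define D where "D u = (\<Sum>b\<in>B. blinfun_scaleR_left b o\<^sub>L blinfun_inner_right (G b u))" for u
  have D: "blinfun_apply (D u) d = (\<Sum>b\<in>B. (G b u \<bullet> d) *\<^sub>R b)" for u d
    by (simp add: D_def blinfun.sum_left)
  have \<tau>b: "\<tau> *\<^sub>R b \<in> V" "norm (\<tau> *\<^sub>R b) \<le> \<tau>" "norm (\<tau> *\<^sub>R b) \<le> \<rho> / 4" if "b \<in> B" for b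
    using that B V \<tau> by (auto simp: subspace_scale)
  have comp: "vpart 0 u \<bullet> b = 1 / \<tau> * (kval 0 u - kval (\<tau> *\<^sub>R b) u)" if "b \<in> B" "u \<in> ?S" for b u
    using kval_tilt_diff[OF that(2) \<tau>b(1,3)[OF that(1)] common[OF \<tau>b(1,2)[OF that(1)] that(2)]] \<tau>
    by (simp add: inner_commute field_simps)
  have expand: "vpart 0 u = (\<Sum>b\<in>B. (1 / \<tau> * (kval 0 u - kval (\<tau> *\<^sub>R b) u)) *\<^sub>R b)" if u: "u \<in> ?S" for u
  proof -
    have "vpart 0 u \<in> span B" using vpart_mem[OF u zero_V] B by simp
    then have "(\<Sum>b\<in>B. (vpart 0 u \<bullet> b) *\<^sub>R b) = vpart 0 u"
      by (intro orthonormal_basis_expand B finB)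
    then show ?thesis using comp[OF _ u] by simp
  qed
  have "(vpart 0 has_derivative blinfun_apply (D u)) (at u within ?S)" if u: "u \<in> ?S" for u
  proof -
    have "((\<lambda>u. \<Sum>b\<in>B. (1 / \<tau> * (kval 0 u - kval (\<tau> *\<^sub>R b) u)) *\<^sub>R b) has_derivative
        (\<lambda>d. \<Sum>b\<in>B. (1 / \<tau> * (tilt 0 u \<bullet> d - tilt (\<tau> *\<^sub>R b) u \<bullet> d)) *\<^sub>R b)) (at u within ?S)"
      by (intro has_derivative_sum has_derivative_scaleR_left has_derivative_mult_right has_derivative_diff
          kval_has_derivative zero_V \<tau>b \<epsilon>_small u)
    moreover have "(\<lambda>d. \<Sum>b\<in>B. (1 / \<tau> * (tilt 0 u \<bullet> d - tilt (\<tau> *\<^sub>R b) u \<bullet> d)) *\<^sub>R b) = blinfun_apply (D u)"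
      by (intro ext) (simp only: D G_def inner_diff_left inner_scaleR_left)
    ultimately have "((\<lambda>u. \<Sum>b\<in>B. (1 / \<tau> * (kval 0 u - kval (\<tau> *\<^sub>R b) u)) *\<^sub>R b) has_derivative
        blinfun_apply (D u)) (at u within ?S)" by (simp only:)
    from has_derivative_transform[OF u expand this] show ?thesis by simp
  qed
  moreover have "continuous_on ?S D"
  proof -
    have "continuous_on ?S (tilt z)" if "z \<in> V" "norm z \<le> \<rho> / 4" for z
      using tilt_lipschitz[OF that \<epsilon>_small] by (rule lipschitz_on_continuous_on)
    then show ?thesis
      unfolding D_def G_def using zero_V \<tau>b by (intro continuous_intros) auto
  qed
  moreover have "blinfun_apply (D u) d \<in> V" for u d
    unfolding D using B V by (intro subspace_sum subspace_scale) auto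
  ultimately show ?thesis
    by (intro that[of D]) (auto simp: C1_with_derivative_on_def)
qed

end

end

section \<open>Charts of a closed ball and of graphs over it\<close>

lemma C1_with_derivative_on_imp_continuous_on:
  "C1_with_derivative_on S F D \<Longrightarrow> continuous_on S F"
  unfolding C1_with_derivative_on_def by (rule has_derivative_continuous_on[where f' = "\<lambda>x. blinfun_apply (D x)"]) simp

lemma C1_with_derivative_on_compose:
  assumes F: "C1_with_derivative_on S F DF" and H: "C1_with_derivative_on T H DH"
    and sub: "F ` S \<subseteq> T"
  shows "C1_with_derivative_on S (\<lambda>x. H (F x)) (\<lambda>x. DH (F x) o\<^sub>L DF x)"
  unfolding C1_with_derivative_on_def
proof (intro conjI ballI)
  fix x assume x: "x \<in> S"
  have "(H has_derivative blinfun_apply (DH (F x))) (at (F x) within F ` S)"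
    using H x sub has_derivative_subset unfolding C1_with_derivative_on_def by blast
  moreover have "(F has_derivative blinfun_apply (DF x)) (at x within S)"
    using F x unfolding C1_with_derivative_on_def by blast
  ultimately have "((\<lambda>x. H (F x)) has_derivative (\<lambda>d. blinfun_apply (DH (F x)) (blinfun_apply (DF x) d))) (at x within S)"
    using has_derivative_in_compose by blast
  moreover have "blinfun_apply (DH (F x) o\<^sub>L DF x) = (\<lambda>d. blinfun_apply (DH (F x)) (blinfun_apply (DF x) d))"
    by (intro ext) simp
  ultimately show "((\<lambda>x. H (F x)) has_derivative blinfun_apply (DH (F x) o\<^sub>L DF x)) (at x within S)"
    by (simp only:)
next
  have "continuous_on T DH" using H unfolding C1_with_derivative_on_def by (rule conjunct2)
  then have "continuous_on S (\<lambda>x. DH (F x))"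
    by (rule continuous_on_compose2[OF _ C1_with_derivative_on_imp_continuous_on[OF F] sub])
  then show "continuous_on S (\<lambda>x. DH (F x) o\<^sub>L DF x)"
    using F unfolding C1_with_derivative_on_def by (intro continuous_intros) auto
qed

text \<open>The inversion \<open>y \<mapsto> y / \<bar>y\<bar>\<^sup>2\<close> maps the sphere of radius \<open>r\<close> around \<open>u\<^sub>0\<close>, \<open>\<bar>u\<^sub>0\<bar> = r\<close>, punctured at
  the origin onto a hyperplane; shifting both sides turns it into a chart of the closed ball without
  the antipode of \<open>u\<^sub>0\<close> over a closed half-space.\<close>

definition inversion :: "'a::real_inner \<Rightarrow> 'a" where
  "inversion y = y /\<^sub>R (y \<bullet> y)"

text \<open>At \<open>y \<noteq> 0\<close> this is |y|^-2 times the reflection in the hyperplane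
  orthogonal to \<open>y\<close>.\<close>

definition inversion_deriv :: "'a::euclidean_space \<Rightarrow> 'a \<Rightarrow>\<^sub>L 'a" where
  "inversion_deriv y = inverse (y \<bullet> y) *\<^sub>R id_blinfun -
     (2 * inverse (y \<bullet> y) * inverse (y \<bullet> y)) *\<^sub>R (blinfun_scaleR_left y o\<^sub>L blinfun_inner_right y)"

lemma inversion_deriv_apply:
  "blinfun_apply (inversion_deriv y) d = d /\<^sub>R (y \<bullet> y) - (2 * (y \<bullet> d) / (y \<bullet> y)\<^sup>2) *\<^sub>R y"
  by (simp add: inversion_deriv_def blinfun.diff_left blinfun.scaleR_left power2_eq_square field_simps)

lemma inversion_deriv_injective:
  assumes "y \<noteq> 0" "blinfun_apply (inversion_deriv y) d = 0"
  shows "d = 0"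
proof -
  have eq: "d /\<^sub>R (y \<bullet> y) = (2 * (y \<bullet> d) / (y \<bullet> y)\<^sup>2) *\<^sub>R y"
    using assms(2) by (simp add: inversion_deriv_apply)
  then have "y \<bullet> (d /\<^sub>R (y \<bullet> y)) = y \<bullet> ((2 * (y \<bullet> d) / (y \<bullet> y)\<^sup>2) *\<^sub>R y)" by simp
  then have "y \<bullet> d = 0" using assms(1) by (simp add: power2_eq_square field_simps)
  then show ?thesis using eq assms(1) by simp
qed

lemma inversion_C1:
  fixes b :: "'a::euclidean_space"
  assumes "\<And>x. x \<in> S \<Longrightarrow> x + b \<noteq> 0"
  shows "C1_with_derivative_on S (\<lambda>x. inversion (x + b) - b') (\<lambda>x. inversion_deriv (x + b))"
  unfolding C1_with_derivative_on_def
proof (intro conjI ballI)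
  fix x assume "x \<in> S"
  then have x: "x + b \<noteq> 0" using assms by blast
  have inv: "((\<lambda>x. inverse ((x + b) \<bullet> (x + b))) has_derivative
      (\<lambda>d. - (inverse ((x + b) \<bullet> (x + b)) * ((x + b) \<bullet> d + d \<bullet> (x + b)) * inverse ((x + b) \<bullet> (x + b)))))
      (at x within S)"
  proof -
    have "((\<lambda>x. (x + b) \<bullet> (x + b)) has_derivative (\<lambda>d. (x + b) \<bullet> d + d \<bullet> (x + b))) (at x within S)"
      by (auto intro!: derivative_eq_intros)
    from Deriv.has_derivative_inverse[OF _ this] x show ?thesis by simp
  qed
  have "((\<lambda>x. inverse ((x + b) \<bullet> (x + b)) *\<^sub>R (x + b) - b') has_derivative
      (\<lambda>d. inverse ((x + b) \<bullet> (x + b)) *\<^sub>R d +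
        (- (inverse ((x + b) \<bullet> (x + b)) * ((x + b) \<bullet> d + d \<bullet> (x + b)) * inverse ((x + b) \<bullet> (x + b)))) *\<^sub>R (x + b)))
      (at x within S)"
    by (rule derivative_eq_intros inv refl)+ simp
  moreover have "(\<lambda>d. inverse ((x + b) \<bullet> (x + b)) *\<^sub>R d +
        (- (inverse ((x + b) \<bullet> (x + b)) * ((x + b) \<bullet> d + d \<bullet> (x + b)) * inverse ((x + b) \<bullet> (x + b)))) *\<^sub>R (x + b))
      = blinfun_apply (inversion_deriv (x + b))"
  proof -
    have "inverse (y \<bullet> y) *\<^sub>R d + (- (inverse (y \<bullet> y) * (y \<bullet> d + d \<bullet> y) * inverse (y \<bullet> y))) *\<^sub>R y
        = blinfun_apply (inversion_deriv y) d" for y d :: 'a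
      by (simp add: inversion_deriv_apply inner_commute[of d y] power2_eq_square divide_inverse mult_ac)
    then show ?thesis by (intro ext)
  qed
  ultimately show "((\<lambda>x. inversion (x + b) - b') has_derivative blinfun_apply (inversion_deriv (x + b))) (at x within S)"
    by (simp add: inversion_def)
next
  show "continuous_on S (\<lambda>x. inversion_deriv (x + b))"
    unfolding inversion_deriv_def using assms by (intro continuous_intros) auto
qed

lemma inversion_inversion: "inversion (inversion y) = y"
  by (cases "y = 0") (auto simp: inversion_def field_simps)

lemma ball_inversion_chart:
  fixes u0 :: "'a::euclidean_space"
  assumes U: "subspace U" and r: "r > 0" and u0: "u0 \<in> U" "norm u0 = r"
  obtains \<phi> \<phi>' D where
    "homeomorphism {x \<in> U. 0 \<le> u0 \<bullet> x} (U \<inter> cball 0 r - {- u0}) \<phi> \<phi>'"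
    "C1_with_derivative_on {x \<in> U. 0 \<le> u0 \<bullet> x} \<phi> D"
    "\<And>x d. x \<in> U \<Longrightarrow> 0 \<le> u0 \<bullet> x \<Longrightarrow> d \<in> U \<Longrightarrow> blinfun_apply (D x) d \<in> U"
    "\<And>x d. x \<in> U \<Longrightarrow> 0 \<le> u0 \<bullet> x \<Longrightarrow> blinfun_apply (D x) d = 0 \<Longrightarrow> d = 0"
proof -
  let ?H = "{x \<in> U. 0 \<le> u0 \<bullet> x}" and ?B = "U \<inter> cball 0 r - {- u0}"
  \<comment> \<open>\<open>b\<close> is the inversion of \<open>2 *\<^sub>R u0\<close>, so
    \<open>\<phi>\<close> sends 0 to \<open>u0\<close>; as \<open>u0 \<bullet> b = 1 / 2\<close>,
    subtracting \<open>b\<close> moves the bounding hyperplane to the origin.\<close>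
  define b where "b = (1 / (2 * r\<^sup>2)) *\<^sub>R u0"
  define \<phi> where "\<phi> x = inversion (x + b) - u0" for x
  define \<phi>' where "\<phi>' u = inversion (u + u0) - b" for u
  have u0sq: "u0 \<bullet> u0 = r\<^sup>2" using u0 by (simp add: dot_square_norm)
  have bU: "b \<in> U" using u0 U by (simp add: b_def subspace_scale)
  have u0b: "u0 \<bullet> b = 1 / 2" using r by (simp add: b_def u0sq)
  have inU: "inversion y \<in> U" if "y \<in> U" for y using that U by (simp add: inversion_def subspace_scale)
  have H0: "x + b \<noteq> 0" if "x \<in> ?H" for x
  proof
    assume "x + b = 0"
    then have "u0 \<bullet> (x + b) = 0" by simp
    then show False using that u0b by (simp add: inner_add_right)
  qed
  have inv0: "inversion y \<noteq> 0" if "y \<noteq> 0" for y :: 'a using that by (simp add: inversion_def)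
  have ball_iff: "norm (y - u0) \<le> r \<longleftrightarrow> y \<bullet> y \<le> 2 * (u0 \<bullet> y)" for y
  proof -
    have "norm (y - u0) \<le> r \<longleftrightarrow> (norm (y - u0))\<^sup>2 \<le> r\<^sup>2"
      using r by (simp add: abs_le_square_iff[symmetric])
    also have "(norm (y - u0))\<^sup>2 = y \<bullet> y - 2 * (u0 \<bullet> y) + r\<^sup>2"
      by (simp add: power2_norm_eq_inner inner_diff_left inner_diff_right u0sq inner_commute[of y u0])
    finally show ?thesis by simp
  qed
  \<comment> \<open>Dividing by \<open>y \<bullet> y\<close> makes the quadratic condition for the
    ball linear in the inverted point.\<close>
  have half_iff: "y \<bullet> y \<le> 2 * (u0 \<bullet> y) \<longleftrightarrow> 1 / 2 \<le> u0 \<bullet> inversion y" if "y \<noteq> 0" for y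
    using that by (simp add: inversion_def field_simps)
  have \<phi>: "\<phi> x \<in> ?B" if x: "x \<in> ?H" for x
  proof -
    let ?y = "inversion (x + b)"
    have y0: "?y \<noteq> 0" using H0[OF x] inv0 by blast
    have "norm (?y - u0) \<le> r"
      unfolding ball_iff half_iff[OF y0] using x u0b by (simp add: inversion_inversion inner_add_right)
    moreover have "?y \<in> U" using x bU U by (intro inU) (simp add: subspace_add)
    ultimately show ?thesis using y0 u0 U by (auto simp: \<phi>_def subspace_diff)
  qed
  have \<phi>': "\<phi>' u \<in> ?H" if u: "u \<in> ?B" for u
  proof -
    have y0: "u + u0 \<noteq> 0" using u by (auto simp: add_eq_0_iff2)
    have "norm ((u + u0) - u0) \<le> r" using u by simp
    then have "1 / 2 \<le> u0 \<bullet> inversion (u + u0)" unfolding ball_iff half_iff[OF y0] .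
    moreover have "inversion (u + u0) \<in> U" using u u0 U by (intro inU) (simp add: subspace_add)
    ultimately show ?thesis using bU U u0b by (simp add: \<phi>'_def subspace_diff inner_diff_right)
  qed
  have C1: "C1_with_derivative_on ?H \<phi> (\<lambda>x. inversion_deriv (x + b))"
    unfolding \<phi>_def by (rule inversion_C1) (use H0 in blast)
  have C1': "C1_with_derivative_on ?B \<phi>' (\<lambda>x. inversion_deriv (x + u0))"
    unfolding \<phi>'_def by (rule inversion_C1) (auto simp: add_eq_0_iff2)
  have "homeomorphism ?H ?B \<phi> \<phi>'"
  proof (rule homeomorphismI)
    show "continuous_on ?H \<phi>" "continuous_on ?B \<phi>'"
      by (rule C1_with_derivative_on_imp_continuous_on[OF C1] C1_with_derivative_on_imp_continuous_on[OF C1'])+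
    show "\<phi> ` ?H \<subseteq> ?B" by (rule image_subsetI) (rule \<phi>)
    show "\<phi>' ` ?B \<subseteq> ?H" by (rule image_subsetI) (rule \<phi>')
  qed (simp_all add: \<phi>_def \<phi>'_def inversion_inversion)
  moreover have "blinfun_apply (inversion_deriv (x + b)) d \<in> U" if "x \<in> U" "d \<in> U" for x d
    using that bU U by (simp add: inversion_deriv_apply subspace_diff subspace_scale subspace_add)
  moreover have "d = 0" if "x \<in> U" "0 \<le> u0 \<bullet> x" "blinfun_apply (inversion_deriv (x + b)) d = 0" for x d
    using inversion_deriv_injective[OF H0] that by blast
  ultimately show ?thesis using that C1 by blast
qed

text \<open>At an interior point the identity on the open ball works with \<open>a = 0\<close>; at a
  boundary point \<open>u\<close> the inversion chart works with \<open>a = u\<close> and omits only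
  \<open>- u\<close>.\<close>

lemma ball_local_chart:
  fixes u :: "'a::euclidean_space"
  assumes U: "subspace U" and r: "r > 0" and u: "u \<in> U \<inter> cball 0 r"
  obtains W a \<Omega> \<phi> \<phi>' D where
    "openin (top_of_set (U \<inter> cball 0 r)) W" "u \<in> W"
    "openin (top_of_set {x \<in> U. 0 \<le> a \<bullet> x}) \<Omega>" "homeomorphism \<Omega> W \<phi> \<phi>'"
    "C1_with_derivative_on \<Omega> \<phi> D"
    "\<And>x d. x \<in> \<Omega> \<Longrightarrow> d \<in> U \<Longrightarrow> blinfun_apply (D x) d \<in> U"
    "\<And>x d. x \<in> \<Omega> \<Longrightarrow> d \<in> U \<Longrightarrow> blinfun_apply (D x) d = 0 \<Longrightarrow> d = 0"
proof (cases "norm u < r")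
  case True
  show ?thesis
  proof (rule that[of "U \<inter> ball 0 r" 0 "U \<inter> ball 0 r" "\<lambda>x. x" "\<lambda>x. x" "\<lambda>_. id_blinfun"])
    have "U \<inter> ball 0 r = (U \<inter> cball 0 r) \<inter> ball 0 r" by auto
    then show "openin (top_of_set (U \<inter> cball 0 r)) (U \<inter> ball 0 r)"
      by (metis open_ball openin_open_Int)
    show "openin (top_of_set {x \<in> U. 0 \<le> 0 \<bullet> x}) (U \<inter> ball 0 r)"
      by (simp add: openin_open_Int)
    show "C1_with_derivative_on (U \<inter> ball 0 r) (\<lambda>x. x) (\<lambda>_. id_blinfun)"
      by (auto simp: C1_with_derivative_on_def blinfun_apply_id_blinfun id_def)
  qed (use True u in \<open>auto simp: homeomorphism_def\<close>)
next
  case False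
  then have u': "u \<in> U" "norm u = r" using u by auto
  obtain \<phi> \<phi>' D where chart:
    "homeomorphism {x \<in> U. 0 \<le> u \<bullet> x} (U \<inter> cball 0 r - {- u}) \<phi> \<phi>'"
    "C1_with_derivative_on {x \<in> U. 0 \<le> u \<bullet> x} \<phi> D"
    "\<And>x d. x \<in> U \<Longrightarrow> 0 \<le> u \<bullet> x \<Longrightarrow> d \<in> U \<Longrightarrow> blinfun_apply (D x) d \<in> U"
    "\<And>x d. x \<in> U \<Longrightarrow> 0 \<le> u \<bullet> x \<Longrightarrow> blinfun_apply (D x) d = 0 \<Longrightarrow> d = 0"
    by (rule ball_inversion_chart[OF U r u']) blast
  have "u \<noteq> - u"
  proof
    assume "u = - u"
    then have "2 *\<^sub>R u = 0" by (metis add.right_inverse scaleR_2)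
    then show False using u' r by simp
  qed
  then show ?thesis
    using u chart by (intro that[of "U \<inter> cball 0 r - {- u}" u _ \<phi> \<phi>' D]) (auto simp: openin_delete)
qed

text \<open>A chart of the ball is followed by the map \<open>u + v u\<close>, whose inverse is the
  projection onto \<open>U\<close>. The derivative stays injective because \<open>Dv\<close> maps
  into \<open>V\<close>, so the \<open>U\<close>-part of a tangent vector survives.\<close>

lemma C1_manifold_graph:
  fixes v :: "'a::euclidean_space \<Rightarrow> 'a"
  assumes U: "subspace U" and r: "r > 0"
    and C1: "C1_with_derivative_on (U \<inter> cball 0 r) v Dv"
    and orth: "\<And>x u. x \<in> V \<Longrightarrow> u \<in> U \<Longrightarrow> x \<bullet> u = 0"
    and vV: "\<And>u. u \<in> U \<inter> cball 0 r \<Longrightarrow> v u \<in> V"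
    and DV: "\<And>u d. u \<in> U \<inter> cball 0 r \<Longrightarrow> blinfun_apply (Dv u) d \<in> V"
  shows "C1_manifold {u + v u |u. u \<in> U \<inter> cball 0 r}"
  unfolding C1_manifold_def
proof (intro exI[of _ "dim U"] ballI)
  let ?S = "U \<inter> cball 0 r" and ?M = "{u + v u |u. u \<in> U \<inter> cball 0 r}"
  define \<gamma> where "\<gamma> u = u + v u" for u
  have contv: "continuous_on ?S v"
    by (rule C1_with_derivative_on_imp_continuous_on[OF C1])
  have proj: "closest_point U (\<gamma> u) = u" if "u \<in> ?S" for u
    using that orth vV U by (intro closest_point_eq_orthogonal_projection) (auto simp: \<gamma>_def)
  have contP: "continuous_on T (closest_point U)" for T
    using linear_closest_point[OF U] by (rule linear_continuous_on[OF linear_conv_bounded_linear[THEN iffD1]])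
  have M: "?M = \<gamma> ` ?S" by (auto simp: \<gamma>_def)
  have \<gamma>hom: "homeomorphism ?S (\<gamma> ` ?S) \<gamma> (closest_point U)"
  proof (rule homeomorphismI)
    show "continuous_on ?S \<gamma>" unfolding \<gamma>_def by (intro continuous_intros contv)
  qed (use contP proj in auto)
  have \<gamma>C1: "C1_with_derivative_on ?S \<gamma> (\<lambda>u. id_blinfun + Dv u)"
    using C1 unfolding C1_with_derivative_on_def \<gamma>_def
    by (auto intro!: derivative_eq_intros continuous_intros simp: blinfun.add_left)
  fix p assume "p \<in> ?M"
  then obtain u where u: "u \<in> ?S" "p = \<gamma> u" by (auto simp: \<gamma>_def)
  obtain W a \<Omega> \<phi> \<phi>' D where chart:
    "openin (top_of_set ?S) W" "u \<in> W"
    "openin (top_of_set {x \<in> U. 0 \<le> a \<bullet> x}) \<Omega>" "homeomorphism \<Omega> W \<phi> \<phi>'"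
    "C1_with_derivative_on \<Omega> \<phi> D"
    "\<And>x d. x \<in> \<Omega> \<Longrightarrow> d \<in> U \<Longrightarrow> blinfun_apply (D x) d \<in> U"
    "\<And>x d. x \<in> \<Omega> \<Longrightarrow> d \<in> U \<Longrightarrow> blinfun_apply (D x) d = 0 \<Longrightarrow> d = 0"
    by (rule ball_local_chart[OF U r u(1)]) blast
  have WS: "W \<subseteq> ?S" using chart(1) openin_imp_subset by blast
  have \<phi>W: "\<phi> ` \<Omega> = W" using chart(4) by (simp add: homeomorphism_def)
  have op: "openin (top_of_set ?M) (\<gamma> ` W)"
    unfolding M by (rule homeomorphism_imp_open_map[OF \<gamma>hom chart(1)])
  have hom: "homeomorphism \<Omega> (\<gamma> ` W) (\<gamma> \<circ> \<phi>) (\<phi>' \<circ> closest_point U)"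
    by (rule homeomorphism_compose[OF chart(4)])
      (rule homeomorphism_of_subsets[OF \<gamma>hom WS subset_refl refl])
  have C1\<phi>: "C1_with_derivative_on \<Omega> (\<gamma> \<circ> \<phi>) (\<lambda>x. (id_blinfun + Dv (\<phi> x)) o\<^sub>L D x)"
    using C1_with_derivative_on_compose[OF chart(5) \<gamma>C1] \<phi>W WS by (simp add: o_def)
  have inj: "d = 0" if x: "x \<in> \<Omega>" "d \<in> U" and z: "blinfun_apply ((id_blinfun + Dv (\<phi> x)) o\<^sub>L D x) d = 0" for x d
  proof -
    let ?d = "blinfun_apply (D x) d"
    have dU: "?d \<in> U" using chart(6) x by blast
    have "\<phi> x \<in> ?S" using x \<phi>W WS by blast
    then have "blinfun_apply (Dv (\<phi> x)) ?d \<bullet> ?d = 0" using DV orth dU by blast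
    moreover have "(?d + blinfun_apply (Dv (\<phi> x)) ?d) \<bullet> ?d = 0"
      using z by (simp add: blinfun.add_left)
    ultimately have "?d = 0" by (simp add: inner_add_left)
    then show ?thesis using chart(7) x by blast
  qed
  show "\<exists>W T a \<Omega> \<phi> \<phi>' D. openin (top_of_set ?M) W \<and> p \<in> W \<and> subspace T \<and> dim T = dim U \<and>
      openin (top_of_set {x \<in> T. 0 \<le> a \<bullet> x}) \<Omega> \<and> homeomorphism \<Omega> W \<phi> \<phi>' \<and>
      C1_with_derivative_on \<Omega> (\<phi> :: 'a \<Rightarrow> 'a) D \<and>
      (\<forall>x\<in>\<Omega>. \<forall>d\<in>T. blinfun_apply (D x) d = 0 \<longrightarrow> d = 0)"
    by (rule exI[of _ "\<gamma> ` W"], rule exI[of _ U], rule exI[of _ a], rule exI[of _ \<Omega>],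
        rule exI[of _ "\<gamma> \<circ> \<phi>"], rule exI[of _ "\<phi>' \<circ> closest_point U"],
        rule exI[of _ "\<lambda>x. (id_blinfun + Dv (\<phi> x)) o\<^sub>L D x"])
      (use op hom C1\<phi> inj chart(2,3) u(2) U in blast)
qed

section \<open>From the hypotheses on f to the tilted setting, and the conclusion\<close>

lemma (in tilted_minimisers) tilted_minimisers_mono:
  "0 < \<rho>' \<Longrightarrow> \<rho>' \<le> \<rho> \<Longrightarrow> tilted_minimisers F M e \<rho>' L"
  by unfold_locales
    (use e_pos M_zero M_mem F_finite M_min lipschitz_on_subset[OF M_lipschitz subset_ball] in auto)

text \<open>The minimal values are finite: properness excludes \<open>-\<infinity>\<close> and
  \<open>argmin_on\<close> excludes \<open>\<infinity>\<close>. The rest is a translation by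
  \<open>xb\<close>.\<close>

lemma tilt_stable_imp_tilted_minimisers:
  assumes "proper_fun f" "tilt_stable_local_min f xb"
  obtains M e \<rho> L where "tilted_minimisers (\<lambda>w. f (xb + w)) M e \<rho> L"
proof -
  obtain e \<rho> m L where e: "e > 0" "\<rho> > 0"
    and m: "\<And>z. z \<in> ball 0 \<rho> \<Longrightarrow> argmin_on (cball xb e) (\<lambda>x. f x - ereal (x \<bullet> z)) = {m z}"
    and lip: "L-lipschitz_on (ball 0 \<rho>) m" and m0: "m 0 = xb"
    using assms(2) unfolding tilt_stable_local_min_def by blast
  have mem: "m z \<in> argmin_on (cball xb e) (\<lambda>x. f x - ereal (x \<bullet> z))" if "norm z < \<rho>" for z
    using m[of z] that by simp
  have fin: "\<bar>f (m z)\<bar> \<noteq> \<infinity>" if "norm z < \<rho>" for z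
    using mem[OF that] assms(1) by (cases "f (m z)") (auto simp: argmin_on_def proper_fun_def)
  have "tilted_minimisers (\<lambda>w. f (xb + w)) (\<lambda>z. m z - xb) e \<rho> L"
  proof
    show "L-lipschitz_on (ball 0 \<rho>) (\<lambda>z. m z - xb)"
      using lip by (simp add: lipschitz_on_def dist_norm)
    fix z :: 'a assume z: "norm z < \<rho>"
    show "norm (m z - xb) \<le> e"
      using mem[OF z] by (simp add: argmin_on_def dist_norm norm_minus_commute)
    show "\<bar>f (xb + (m z - xb))\<bar> \<noteq> \<infinity>" using fin[OF z] by simp
    fix w :: 'a assume w: "norm w \<le> e"
    obtain r where r: "f (m z) = ereal r" using fin[OF z] by auto
    have "xb + w \<in> cball xb e" using w by (simp add: dist_norm)
    then have "f (m z) - ereal (m z \<bullet> z) \<le> f (xb + w) - ereal ((xb + w) \<bullet> z)"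
      using mem[OF z] unfolding argmin_on_def by blast
    then show "f (xb + (m z - xb)) + ereal (z \<bullet> (w - (m z - xb))) \<le> f (xb + w)"
      by (cases "f (xb + w)") (auto simp: r inner_commute[of z] inner_add_left inner_diff_left)
  qed (use e m0 in auto)
  then show ?thesis by (rule that)
qed

lemma VU_tilted_exists:
  fixes f :: "real^'n \<Rightarrow> ereal"
  assumes proper: "proper_fun f" and reg: "prox_regular f xb 0"
    and dom: "effective_dom (rank1_support (lim_subhessians f xb 0)) = Uspace f xb"
    and tilt: "tilt_stable_local_min f xb" and rel: "0 \<in> rel_interior (lim_subdiff f xb)"
  obtains M e \<rho> L c where "VU_tilted (\<lambda>w. f (xb + w)) M e \<rho> L (Vspace f xb) c"
proof -
  let ?F = "\<lambda>w. f (xb + w)" and ?V = "Vspace f xb"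
  obtain M e \<rho> L where "tilted_minimisers ?F M e \<rho> L"
    using tilt_stable_imp_tilted_minimisers[OF proper tilt] by blast
  then interpret tilted_minimisers ?F M e \<rho> L .
  obtain s where s: "s > 0" "cball 0 s \<inter> affine hull (lim_subdiff f xb) \<subseteq> lim_subdiff f xb"
    using rel unfolding mem_rel_interior_cball by blast
  \<comment> \<open>As 0 is a subgradient, the affine hull is the span; the relative interior
    condition thus gives a ball of \<open>V\<close> consisting of subgradients.\<close>
  have "affine hull (lim_subdiff f xb) = ?V"
    unfolding Vspace_def using rel rel_interior_subset hull_subset[of "lim_subdiff f xb" affine]
    by (intro affine_hull_span_0) blast
  then have sV: "z \<in> lim_subdiff f xb" if "z \<in> ?V" "norm z \<le> s" for z
    using s that by (simp add: subset_iff)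
  obtain r0 where fxb: "f xb = ereal r0" using reg unfolding prox_regular_def by auto
  obtain d r where d: "d > 0" "r \<ge> 0" and prox: "\<And>x x' z. norm (x' - xb) \<le> d \<and> norm (x - xb) \<le> d \<and>
      \<bar>f x - f xb\<bar> \<le> ereal d \<and> norm (z - 0) \<le> d \<and> z \<in> lim_subdiff f x \<Longrightarrow>
      f x' \<ge> f x + ereal (z \<bullet> (x' - x) - r / 2 * (norm (x' - x))\<^sup>2)"
    using reg unfolding prox_regular_def by blast
  \<comment> \<open>Prox-regularity is applied at the single point \<open>xb\<close>, with all small
    \<open>z \<in> V\<close> as subgradients.\<close>
  have "\<exists>\<tau>>0. \<forall>z\<in>?V. norm z \<le> \<tau> \<longrightarrow> M z = 0"
  proof (rule M_eq_0_of_prox_subgradients[OF d(2), of "min s d"])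
    fix z w :: "real^'n" assume z: "z \<in> ?V" "norm z \<le> min s d" and w: "norm w \<le> min s d"
    show "f (xb + 0) + ereal (z \<bullet> w - r / 2 * (norm w)\<^sup>2) \<le> f (xb + w)"
      using prox[of "xb + w" xb z] sV[OF z(1)] z w d by (simp add: fxb)
  qed (use s d in simp)
  then obtain \<tau> where \<tau>: "\<tau> > 0" "\<And>z. z \<in> ?V \<Longrightarrow> norm z \<le> \<tau> \<Longrightarrow> M z = 0" by blast
  have "\<exists>c>0. \<exists>\<eta>>0. \<eta> \<le> \<rho> \<and> (\<forall>z z'. norm z < \<eta> \<and> norm z' < \<eta> \<and> z' - z \<in> Uspace f xb \<longrightarrow>
    c * (norm (z' - z))\<^sup>2 \<le> (M z' - M z) \<bullet> (z' - z))"
  proof (rule strongly_monotone_along)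
    show "tilted_minimisers ?F M e \<rho> L" by unfold_locales
    show "subspace (Uspace f xb)" unfolding Uspace_def by (rule subspace_orthogonal_comp)
    show "rank1_support (lim_subhessians f xb 0) h < \<infinity>" if "h \<in> Uspace f xb" for h
      using that unfolding dom[symmetric] by (simp add: effective_dom_def)
  qed
  then obtain c \<eta> where c: "c > 0" "\<eta> > 0" "\<eta> \<le> \<rho>"
    and mono: "\<And>z z'. norm z < \<eta> \<Longrightarrow> norm z' < \<eta> \<Longrightarrow> z' - z \<in> Uspace f xb \<Longrightarrow>
      c * (norm (z' - z))\<^sup>2 \<le> (M z' - M z) \<bullet> (z' - z)"
    by blast
  have "VU_tilted ?F M e (min \<tau> \<eta>) L ?V c"
  proof (rule VU_tilted.intro)
    show "tilted_minimisers ?F M e (min \<tau> \<eta>) L"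
      by (rule tilted_minimisers_mono) (use \<tau> c in auto)
    show "VU_tilted_axioms M (min \<tau> \<eta>) ?V c"
    proof
      show "subspace ?V" by (simp add: Vspace_def)
      show "c > 0" by (rule c(1))
      show "M z = 0" if "z \<in> ?V" "norm z < min \<tau> \<eta>" for z using that \<tau> by simp
      show "c * (norm (z' - z))\<^sup>2 \<le> (M z' - M z) \<bullet> (z' - z)"
        if "norm z < min \<tau> \<eta>" "norm z' < min \<tau> \<eta>" "z' - z \<in> ?V\<^sup>\<bottom>" for z z'
        using that by (intro mono) (auto simp: Uspace_def)
    qed
  qed
  then show ?thesis by (rule that)
qed

theorem theorem2:
  fixes f :: "real^'n \<Rightarrow> ereal" and xb :: "real^'n"
    and \<epsilon>\<^sub>0 :: real and v\<^sub>0 :: "real^'n \<Rightarrow> real^'n"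
  assumes "proper_fun f" and "lsc_fun f"
    and "quadratically_minorised f xb"
    and "prox_regular f xb 0"
    and "effective_dom (rank1_support (lim_subhessians f xb 0)) = Uspace f xb"
    and "subspace (effective_dom (rank1_support (lim_subhessians f xb 0)))"
    and "tilt_stable_local_min f xb"
    and "0 \<in> rel_interior (lim_subdiff f xb)"
    and "\<epsilon>\<^sub>0 > 0"
    and "argmin_selection f xb \<epsilon>\<^sub>0 v\<^sub>0"
    and "\<And>u. u \<in> Uball f xb \<epsilon>\<^sub>0 \<Longrightarrow> singular_subdiff f (xb + u + v\<^sub>0 u) = {0}"
  shows "\<exists>\<epsilon>. 0 < \<epsilon> \<and> \<epsilon> \<le> \<epsilon>\<^sub>0 \<and>
    (\<exists>v. argmin_selection f xb \<epsilon> v) \<and>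
    (\<forall>v. argmin_selection f xb \<epsilon> v \<longrightarrow>
      (\<forall>u\<in>Uball f xb \<epsilon>. \<bar>f (xb + u + v u)\<bar> \<noteq> \<infinity> \<and> gfun f xb \<epsilon> (u + v u) = f (xb + u + v u)) \<and>
      (\<exists>G. C11_with_gradient_on (Uspace f xb) (Uball f xb \<epsilon>)
             (\<lambda>u. real_of_ereal (gfun f xb \<epsilon> (u + v u))) G \<and>
           (\<forall>u\<in>Uball f xb \<epsilon>. norm u < \<epsilon> \<longrightarrow>
             (\<forall>D. (v has_derivative D) (at u within Uball f xb \<epsilon>) \<longrightarrow>
               VU_transpose (Uspace f xb) (Vspace f xb) D ` convex_subdiff (gfun f xb \<epsilon>) (u + v u)
                 = {G u}))) \<and>
      (\<forall>\<delta>. 0 < \<delta> \<and> \<delta> \<le> \<epsilon> \<and> Vball f xb \<delta> \<subseteq> V_subdiff f xb \<and>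
           (\<forall>z\<in>Vball f xb \<delta>. \<forall>u\<in>Uball f xb \<epsilon>.
              argmin_on (Vball f xb \<epsilon>) (\<lambda>v'. f (xb + u + v') - ereal (z \<bullet> v')) = {v u})
         \<longrightarrow>
           C1_manifold {u + v u |u. u \<in> Uball f xb \<epsilon>} \<and>
           (\<exists>G. C11_with_gradient_on (Uspace f xb) (Uball f xb \<delta>)
                  (\<lambda>u. real_of_ereal (f (xb + u + v u))) G) \<and>
           (\<exists>D. C1_with_derivative_on (Uball f xb \<epsilon>) v D)))"
proof -
  let ?F = "\<lambda>w. f (xb + w)" and ?U = "Uspace f xb" and ?V = "Vspace f xb"
  obtain M e \<rho> L c where "VU_tilted ?F M e \<rho> L ?V c"
    using VU_tilted_exists[OF assms(1,4,5,7,8)] by blast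
  then interpret VU_tilted ?F M e \<rho> L ?V c .
  \<comment> \<open>\<open>tilt\<close> is controlled for radii below
    \<open>c * \<rho> / 16\<close>; 32 makes the bound strict. \<open>e / 2\<close> keeps the sums
    \<open>u + v\<close> in the ball of radius \<open>e\<close>.\<close>
  define \<epsilon> where "\<epsilon> = min \<epsilon>\<^sub>0 (min (e / 2) (c * \<rho> / 32))"
  have \<epsilon>0: "0 < \<epsilon>" "\<epsilon> \<le> \<epsilon>\<^sub>0"
    using assms(9) e_pos c_pos \<rho>_pos by (auto simp: \<epsilon>_def)
  have "c * \<rho> > 0" using c_pos \<rho>_pos by simp
  moreover have "\<epsilon> \<le> c * \<rho> / 32" by (simp add: \<epsilon>_def)
  ultimately have \<epsilon>_small: "\<epsilon> < c * \<rho> / 16" by linarith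
  have "\<epsilon> \<le> e / 2" by (simp add: \<epsilon>_def)
  then have \<epsilon>_e: "2 * \<epsilon> \<le> e" by simp
  note \<epsilon> = \<epsilon>0(1) \<epsilon>_small \<epsilon>_e
  have Uball: "Uball f xb r = U \<inter> cball 0 r" for r by (simp add: Uball_def Uspace_def)
  have Vball: "Vball f xb r = ?V \<inter> cball 0 r" for r by (simp add: Vball_def)
  have gfun: "gfun f xb \<epsilon> = g \<epsilon>"
    by (simp add: gfun_def localised_def[abs_def] g_def[OF \<epsilon>] UV_box_def[OF \<epsilon>] Uball Vball)
  note V0 = zero_V[OF \<epsilon>]
  \<comment> \<open>This gives existence of a selection and reduces all claims about an arbitrary
    one to \<open>vpart 0\<close>.\<close>
  have sel_iff: "argmin_selection f xb \<epsilon> v \<longleftrightarrow> (\<forall>u\<in>U \<inter> cball 0 \<epsilon>. v u = vpart 0 u)" for v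
    unfolding argmin_selection_def gfun Uball Vball using g_argmin[OF \<epsilon>] by simp
  have "argmin_selection f xb \<epsilon> (vpart 0)" by (simp add: sel_iff)
  moreover have
    "(\<forall>u\<in>Uball f xb \<epsilon>. \<bar>f (xb + u + v u)\<bar> \<noteq> \<infinity> \<and> gfun f xb \<epsilon> (u + v u) = f (xb + u + v u)) \<and>
      (\<exists>G. C11_with_gradient_on (Uspace f xb) (Uball f xb \<epsilon>)
             (\<lambda>u. real_of_ereal (gfun f xb \<epsilon> (u + v u))) G \<and>
           (\<forall>u\<in>Uball f xb \<epsilon>. norm u < \<epsilon> \<longrightarrow>
             (\<forall>D. (v has_derivative D) (at u within Uball f xb \<epsilon>) \<longrightarrow>
               VU_transpose (Uspace f xb) (Vspace f xb) D ` convex_subdiff (gfun f xb \<epsilon>) (u + v u)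
                 = {G u}))) \<and>
      (\<forall>\<delta>. 0 < \<delta> \<and> \<delta> \<le> \<epsilon> \<and> Vball f xb \<delta> \<subseteq> V_subdiff f xb \<and>
           (\<forall>z\<in>Vball f xb \<delta>. \<forall>u\<in>Uball f xb \<epsilon>.
              argmin_on (Vball f xb \<epsilon>) (\<lambda>v'. f (xb + u + v') - ereal (z \<bullet> v')) = {v u})
         \<longrightarrow>
           C1_manifold {u + v u |u. u \<in> Uball f xb \<epsilon>} \<and>
           (\<exists>G. C11_with_gradient_on (Uspace f xb) (Uball f xb \<delta>)
                  (\<lambda>u. real_of_ereal (f (xb + u + v u))) G) \<and>
           (\<exists>D. C1_with_derivative_on (Uball f xb \<epsilon>) v D))" (is "?A \<and> ?B \<and> ?C")
    if sel: "argmin_selection f xb \<epsilon> v" for v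
  proof (intro conjI)
    have v: "v u = vpart 0 u" if "u \<in> U \<inter> cball 0 \<epsilon>" for u using sel that by (simp add: sel_iff)
    have fv: "f (xb + u + v u) = ereal (kval 0 u)" if "u \<in> U \<inter> cball 0 \<epsilon>" for u
      using F_graph0[OF \<epsilon> that] v[OF that] by (simp add: add.assoc)
    have gv: "g \<epsilon> (u + v u) = ereal (kval 0 u)" if "u \<in> U \<inter> cball 0 \<epsilon>" for u
      using g_graph[OF \<epsilon> that] v[OF that] by simp
    \<comment> \<open>General \<open>k\<close> and \<open>\<delta>\<close> serve both
      \<open>g\<close> on the ball of radius \<open>\<epsilon>\<close> and \<open>f\<close> on the
      smaller one.\<close>
    have C11: "C11_with_gradient_on ?U (U \<inter> cball 0 \<delta>) k (tilt 0)"
      if \<delta>: "\<delta> \<le> \<epsilon>" and k: "\<And>u. u \<in> U \<inter> cball 0 \<epsilon> \<Longrightarrow> k u = kval 0 u" for \<delta> k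
      unfolding C11_with_gradient_on_def
    proof (intro conjI ballI exI)
      have sub: "U \<inter> cball 0 \<delta> \<subseteq> U \<inter> cball 0 \<epsilon>" using \<delta> by auto
      fix u assume u: "u \<in> U \<inter> cball 0 \<delta>"
      then have u': "u \<in> U \<inter> cball 0 \<epsilon>" using sub by blast
      show "tilt 0 u \<in> ?U"
        using tilt_U[OF V0] S_small[OF \<epsilon> u'] by (simp add: Uspace_def)
      have "(k has_derivative (\<lambda>d. tilt 0 u \<bullet> d)) (at u within U \<inter> cball 0 \<epsilon>)"
        by (rule has_derivative_transform[OF u' k kval_has_derivative[OF V0 \<epsilon>_small u']])
      then show "(k has_derivative (\<lambda>d. tilt 0 u \<bullet> d)) (at u within U \<inter> cball 0 \<delta>)"
        by (rule has_derivative_subset[OF _ sub])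
    next
      have "\<delta> < c * \<rho> / 16" using \<delta> \<epsilon>_small by simp
      then show "(1 / c)-lipschitz_on (U \<inter> cball 0 \<delta>) (tilt 0)"
        by (rule tilt_lipschitz[OF V0])
    qed
    show ?A unfolding Uball gfun using fv gv by simp
    show ?B
    proof (intro exI conjI)
      show "C11_with_gradient_on ?U (Uball f xb \<epsilon>) (\<lambda>u. real_of_ereal (gfun f xb \<epsilon> (u + v u))) (tilt 0)"
        unfolding Uball gfun by (rule C11) (use gv in auto)
      show "\<forall>u\<in>Uball f xb \<epsilon>. norm u < \<epsilon> \<longrightarrow> (\<forall>D. (v has_derivative D) (at u within Uball f xb \<epsilon>) \<longrightarrow>
          VU_transpose ?U ?V D ` convex_subdiff (gfun f xb \<epsilon>) (u + v u) = {tilt 0 u})"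
        unfolding Uball gfun using VU_transpose_convex_subdiff[OF \<epsilon> _ _ v] by (simp add: Uspace_def)
    qed
    show ?C
    proof (intro allI impI, elim conjE)
      fix \<delta> assume \<delta>: "0 < \<delta>" "\<delta> \<le> \<epsilon>"
        and common: "\<forall>z\<in>Vball f xb \<delta>. \<forall>u\<in>Uball f xb \<epsilon>.
          argmin_on (Vball f xb \<epsilon>) (\<lambda>v'. f (xb + u + v') - ereal (z \<bullet> v')) = {v u}"
      \<comment> \<open>Tilts must satisfy both the common argmin assumption and the bound
        \<open>\<rho> / 4\<close> under which \<open>vpart z\<close> is controlled.\<close>
      define \<tau> where "\<tau> = min \<delta> (\<rho> / 4)"
      have \<tau>: "\<tau> > 0" "\<tau> \<le> \<rho> / 4" using \<delta> \<rho>_pos by (auto simp: \<tau>_def)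
      have "vpart z u = vpart 0 u" if z: "z \<in> ?V" "norm z \<le> \<tau>" and u: "u \<in> U \<inter> cball 0 \<epsilon>" for z u
      proof -
        have "argmin_on (?V \<inter> cball 0 \<epsilon>) (\<lambda>v'. f (xb + u + v') - ereal (z \<bullet> v')) = {v u}"
          using common z u by (simp add: Uball Vball \<tau>_def)
        moreover have "norm z \<le> \<rho> / 4" using z \<tau> by simp
        ultimately show ?thesis
          using vpart_argmin_tilted[OF \<epsilon> u z(1)] v[OF u] by (simp add: add.assoc)
      qed
      from vpart_C1[OF \<epsilon> \<tau> this] obtain D
        where D: "C1_with_derivative_on (U \<inter> cball 0 \<epsilon>) (vpart 0) D" "\<And>u d. blinfun_apply (D u) d \<in> ?V"
        by metis
      have C1: "C1_with_derivative_on (U \<inter> cball 0 \<epsilon>) v D"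
        unfolding C1_with_derivative_on_def
      proof (intro conjI ballI)
        fix u assume u: "u \<in> U \<inter> cball 0 \<epsilon>"
        then have "(vpart 0 has_derivative blinfun_apply (D u)) (at u within U \<inter> cball 0 \<epsilon>)"
          using D(1) unfolding C1_with_derivative_on_def by blast
        from has_derivative_transform[OF u v this]
        show "(v has_derivative blinfun_apply (D u)) (at u within U \<inter> cball 0 \<epsilon>)" by simp
      qed (use D(1) in \<open>simp add: C1_with_derivative_on_def\<close>)
      have "C1_manifold {u + v u |u. u \<in> U \<inter> cball 0 \<epsilon>}"
      proof (rule C1_manifold_graph[OF subspace_U \<epsilon>(1) C1])
        show "x \<bullet> u = 0" if "x \<in> ?V" "u \<in> U" for x u using UV_orth(2)[OF that(2,1)] .
        show "v u \<in> ?V" if "u \<in> U \<inter> cball 0 \<epsilon>" for u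
          using vpart_mem[OF \<epsilon> that V0] v[OF that] by simp
      qed (rule D(2))
      moreover have "C11_with_gradient_on ?U (U \<inter> cball 0 \<delta>) (\<lambda>u. real_of_ereal (f (xb + u + v u))) (tilt 0)"
        by (rule C11[OF \<delta>(2)]) (simp add: fv)
      ultimately show "C1_manifold {u + v u |u. u \<in> Uball f xb \<epsilon>} \<and>
           (\<exists>G. C11_with_gradient_on ?U (Uball f xb \<delta>) (\<lambda>u. real_of_ereal (f (xb + u + v u))) G) \<and>
           (\<exists>D. C1_with_derivative_on (Uball f xb \<epsilon>) v D)"
        unfolding Uball using C1 by blast
    qed
  qed
  ultimately show ?thesis using \<epsilon>0 by blast
qed

end
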